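(* Assume $f\in W^{1,\infty}(0,T;L^\infty(\Omega))$ and $\boldsymbol u\in W^{1,\infty}(0,T;\boldsymbol L^\infty(\Omega))$, and let $\boldsymbol b^0\in\boldsymbol V$ be the initial magnetic field. For $\boldsymbol N=(N,M)$ and a time step $\tau=T/K$ ($K$ a positive integer), let $\boldsymbol b_{\boldsymbol N}^n\in \boldsymbol V_{\boldsymbol N}$, $0\le n\le K$, be the solution of the fully discrete spectral scheme: $\boldsymbol b_{\boldsymbol N}^0=\Pi_{\boldsymbol N}\boldsymbol b^0$ and, for $n=1,\dots,K$, $[\boldsymbol b_{\boldsymbol N}^n]=0$ on $\Gamma_1\cup\Gamma_2$ and $$\int_\Omega \partial_\tau \boldsymbol b_{\boldsymbol N}^n\cdot \boldsymbol a_{\boldsymbol N}\,d\boldsymbol x+\int_\Omega\bar\beta\,(\nabla\times\boldsymbol b_{\boldsymbol N}^n)\cdot(\nabla\times\boldsymbol a_{\boldsymbol N})\,d\boldsymbol x=\int_\Omega(\bar\beta-\beta(\boldsymbol x))(\nabla\times\boldsymbol b_{\boldsymbol N}^{n-1})\cdot(\nabla\times\boldsymbol a_{\boldsymbol N})\,d\boldsymbol x$$ $$\qquad+R_\alpha\int_\Omega\frac{\bar f^n}{1+\sigma|\boldsymbol b_{\boldsymbol N}^{n-1}|^2}\,\boldsymbol b_{\boldsymbol N}^{n-1}\cdot(\nabla\times\boldsymbol a_{\boldsymbol N})\,d\boldsymbol x+R_m\int_\Omega(\bar{\boldsymbol u}^n\times\boldsymbol b_{\boldsymbol N}^{n-1})\cdot(\nabla\times\boldsymbol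 a_{\boldsymbol N})\,d\boldsymbol x\qquad\text{for all }\boldsymbol a_{\boldsymbol N}\in\boldsymbol V_{\boldsymbol N}.$$ Then there exists a positive constant $C$, independent of $\boldsymbol N$ and of $\tau$, such that $$\max_{1\le n\le K}\|\boldsymbol b_{\boldsymbol N}^n\|^2+\tau\sum_{n=1}^K\|\nabla\times\boldsymbol b_{\boldsymbol N}^n\|^2\le C\left(\|\boldsymbol b_{\boldsymbol N}^0\|_{\boldsymbol V}^2+\tau\|\nabla\times\boldsymbol b_{\boldsymbol N}^0\|^2\right)$$ and $$\max_{1\le n\le K}\|\nabla\times\boldsymbol b_{\boldsymbol N}^n\|^2+\tau\sum_{n=1}^K\|\partial_\tau\boldsymbol b_{\boldsymbol N}^n\|^2\le C\,\|\boldsymbol b_{\boldsymbol N}^0\|_{\boldsymbol V}^2 .$$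
   Context: Geometry and data. Fix $0<r_1<r_2<r_3$ and $T>0$. $\Omega\subset\mathbb R^3$ is the ball of radius $r_3$ centred at the origin, divided into the core $\Omega_1=\{|\boldsymbol x|<r_1\}$, the convection zone $\Omega_2=\{r_1<|\boldsymbol x|<r_2\}$ and the outer zone $\Omega_3=\{r_2<|\boldsymbol x|<r_3\}$, with interfaces $\Gamma_1=\{|\boldsymbol x|=r_1\}$ and $\Gamma_2=\{|\boldsymbol x|=r_2\}$; $[\cdot]$ denotes the jump across an interface. $R_\alpha,R_m$ are real constants and $\sigma\ge 0$ is a constant. The magnetic diffusivity $\beta(\boldsymbol x)$ satisfies $\beta_1\le\beta(\boldsymbol x)\le\beta_2$ for constants $0<\beta_1\le\beta_2$, and is constant in $\Omega_2$. The piecewise constant $\bar\beta$ is defined by $\bar\beta=\max_{\Omega_i}\beta$ on $\Omega_i$, $i=1,2,3$ (so $\bar\beta=\beta$ on $\Omega_2$). The given scalar function $f(\boldsymbol x,t)$ and the given velocity field $\boldsymbol u(\boldsymbol x,t)$ vanish on $\bar\Omega_1$ and $\bar\Omega_3$. All physical fields are real-valued. The underlying continuous problem is the mean-field dynamo system $\boldsymbol b_t+\nabla\times(\beta\nabla\times\boldsymbol b)=R_\alpha\nabla\times\big(\tfrac{f}{1+\sigma|\boldsymbol b|^2}\boldsymbol b\big)+R_m\nabla\times(\boldsymbol u\times\boldsymbol b)$ in $\Omega\times(0,T)$, with $(\nabla\times\boldsymbol b)\times\boldsymbol n=0$ on $\partial\Omega$ and $\boldsymbol b(\cdot,0)=\boldsymbol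 b^0$. Norms. $\boldsymbol L^2(\Omega)=L^2(\Omega)^3$, $\boldsymbol L^\infty(\Omega)=L^\infty(\Omega)^3$; $\|\cdot\|$ is the $L^2(\Omega)$ (or $\boldsymbol L^2(\Omega)$) norm. $\boldsymbol V=\{\boldsymbol c\in\boldsymbol L^2(\Omega):\nabla\times\boldsymbol c\in\boldsymbol L^2(\Omega)\}$ with $\|\boldsymbol c\|_{\boldsymbol V}^2=\|\boldsymbol c\|^2+\|\nabla\times\boldsymbol c\|^2$. Time discretization. $\tau=T/K$, $t_n=n\tau$; $\partial_\tau v^n=(v^n-v^{n-1})/\tau$; $\bar f^n=\frac1\tau\int_{t_{n-1}}^{t_n}f(\cdot,t)\,dt$ and $\bar{\boldsymbol u}^n=\frac1\tau\int_{t_{n-1}}^{t_n}\boldsymbol u(\cdot,t)\,dt$ for $1\le n\le K$. Discrete space. Let $(r,\theta,\varphi)$ be spherical coordinates with local orthonormal frame $(\boldsymbol e_r,\boldsymbol e_\theta,\boldsymbol e_\varphi)$, let $Y_l^m(\theta,\varphi)=\sqrt{\frac{2l+1}{4\pi}\frac{(l-m)!}{(l+m)!}}\,P_l^m(\cos\theta)e^{im\varphi}$ be the spherical harmonics ($P_l^m$ the associated Legendre functions), $\nabla_S=\boldsymbol e_\theta\,\partial_\theta+\frac1{\sin\theta}\boldsymbol e_\varphi\,\partial_\varphi$, and $\boldsymbol T_l^m=\nabla_SY_l^m\times\boldsymbol e_r$ (which is zero for $l=0$). Let $I_1=[0,r_1]$, $I_2=[r_1,r_2]$, $I_3=[r_2,r_3]$.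 $X_N$ is the space of functions on $[0,r_3]$ that are continuous at $r_1,r_2$ and whose restriction to each $I_i$ is a complex polynomial of degree at most $N$. For $\boldsymbol N=(N,M)$, $\boldsymbol V_{\boldsymbol N}$ is the space of (real-valued) divergence-free vector fields in $\boldsymbol V$ of the form $$\boldsymbol b_{\boldsymbol N}(r,\theta,\varphi)=\sum_{l=0}^M\sum_{|m|\le l}\Big[t_{l,m}^N(r)\,\boldsymbol T_l^m(\theta,\varphi)+\nabla\times\big(A_{l,m}^N(r)\,\boldsymbol T_l^m(\theta,\varphi)\big)\Big],\qquad t_{l,m}^N,\,A_{l,m}^N\in X_N.$$ $\Pi_{\boldsymbol N}$ is a projection onto $\boldsymbol V_{\boldsymbol N}$. *)

theory Defs
  imports "HOL-Analysis.Analysis" "HOL-Probability.Essential_Supremum"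
    "HOL-Computational_Algebra.Polynomial"
begin

section \<open>Geometry and the piecewise constant diffusivity\<close>

definition zone1 :: "real \<Rightarrow> (real^3) set" where
  "zone1 r1 = {x. norm x < r1}"

definition zone2 :: "real \<Rightarrow> real \<Rightarrow> (real^3) set" where
  "zone2 r1 r2 = {x. r1 < norm x \<and> norm x < r2}"

definition zone3 :: "real \<Rightarrow> real \<Rightarrow> (real^3) set" where
  "zone3 r2 r3 = {x. r2 < norm x \<and> norm x < r3}"

text \<open>The maximum over an open zone is read as a supremum. The value on the interfaces, a null
  set, is irrelevant.\<close>

definition beta_bar :: "real \<Rightarrow> real \<Rightarrow> real \<Rightarrow> (real^3 \<Rightarrow> real) \<Rightarrow> real^3 \<Rightarrow> real" where
  "beta_bar r1 r2 r3 \<beta> x =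
     (if x \<in> zone1 r1 then (SUP y\<in>zone1 r1. \<beta> y)
      else if x \<in> zone2 r1 r2 then (SUP y\<in>zone2 r1 r2. \<beta> y)
      else if x \<in> zone3 r2 r3 then (SUP y\<in>zone3 r2 r3. \<beta> y)
      else 0)"


section \<open>Classical differential operators and test functions\<close>

definition partial :: "3 \<Rightarrow> (real^3 \<Rightarrow> 'b::real_normed_vector) \<Rightarrow> real^3 \<Rightarrow> 'b" where
  "partial i F x = frechet_derivative F (at x) (axis i 1)"

definition grad :: "(real^3 \<Rightarrow> real) \<Rightarrow> real^3 \<Rightarrow> real^3" where
  "grad \<psi> x = (\<chi> i. partial i \<psi> x)"

definition curl :: "(real^3 \<Rightarrow> ('a::real_normed_field)^3) \<Rightarrow> real^3 \<Rightarrow> 'a^3" where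
  "curl F x = vector [partial 2 F x $ 3 - partial 3 F x $ 2,
                      partial 3 F x $ 1 - partial 1 F x $ 3,
                      partial 1 F x $ 2 - partial 2 F x $ 1]"

primrec Ck :: "nat \<Rightarrow> ('a::euclidean_space \<Rightarrow> 'b::real_normed_vector) \<Rightarrow> bool" where
  "Ck 0 F \<longleftrightarrow> continuous_on UNIV F"
| "Ck (Suc k) F \<longleftrightarrow> (\<forall>x. F differentiable (at x)) \<and>
     (\<forall>e\<in>Basis. Ck k (\<lambda>x. frechet_derivative F (at x) e))"

text \<open>The functions in \<open>C\<^sub>c\<^sup>\<infinity>(S)\<close>, extended by zero to the whole space.\<close>

definition test_function :: "'a::euclidean_space set \<Rightarrow> ('a \<Rightarrow> 'b::real_normed_vector) \<Rightarrow> bool" where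
  "test_function S \<phi> \<longleftrightarrow> (\<forall>k. Ck k \<phi>) \<and>
     compact (closure {x. \<phi> x \<noteq> 0}) \<and> closure {x. \<phi> x \<noteq> 0} \<subseteq> S"


section \<open>Lebesgue spaces and the space V\<close>

text \<open>Elements of the function spaces are represented by functions; values outside \<open>S\<close> and on null
  sets are irrelevant.\<close>

definition L2 :: "(real^3) set \<Rightarrow> (real^3 \<Rightarrow> real^3) set" where
  "L2 S = {b. b \<in> borel_measurable (lebesgue_on S) \<and>
              integrable (lebesgue_on S) (\<lambda>x. (norm (b x))\<^sup>2)}"

definition L2_norm_on :: "(real^3) set \<Rightarrow> (real^3 \<Rightarrow> real^3) \<Rightarrow> real" where
  "L2_norm_on S b = sqrt (LINT x|lebesgue_on S. (norm (b x))\<^sup>2)"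

definition has_weak_curl :: "(real^3) set \<Rightarrow> (real^3 \<Rightarrow> real^3) \<Rightarrow> (real^3 \<Rightarrow> real^3) \<Rightarrow> bool" where
  "has_weak_curl S b w \<longleftrightarrow> b \<in> L2 S \<and> w \<in> L2 S \<and>
     (\<forall>\<phi>. test_function S \<phi> \<longrightarrow>
        (LINT x|lebesgue_on S. b x \<bullet> curl \<phi> x) = (LINT x|lebesgue_on S. w x \<bullet> \<phi> x))"

text \<open>Determined up to a null set for \<open>b\<close> in the space \<open>V\<close> below.\<close>

definition weak_curl :: "(real^3) set \<Rightarrow> (real^3 \<Rightarrow> real^3) \<Rightarrow> real^3 \<Rightarrow> real^3" where
  "weak_curl S b = (SOME w. has_weak_curl S b w)"

definition Vspace :: "(real^3) set \<Rightarrow> (real^3 \<Rightarrow> real^3) set" where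
  "Vspace S = {b. \<exists>w. has_weak_curl S b w}"

definition V_norm :: "(real^3) set \<Rightarrow> (real^3 \<Rightarrow> real^3) \<Rightarrow> real" where
  "V_norm S b = sqrt ((L2_norm_on S b)\<^sup>2 + (L2_norm_on S (weak_curl S b))\<^sup>2)"

definition weakly_div_free :: "(real^3) set \<Rightarrow> (real^3 \<Rightarrow> real^3) \<Rightarrow> bool" where
  "weakly_div_free S b \<longleftrightarrow>
     (\<forall>\<psi>. test_function S \<psi> \<longrightarrow> (LINT x|lebesgue_on S. b x \<bullet> grad \<psi> x) = 0)"


section \<open>The Bochner--Sobolev space \<open>W\<^sup>1\<^sup>,\<^sup>\<infinity>(0,T;L\<^sup>\<infinity>(S))\<close>\<close>

definition Linf_norm :: "'a::euclidean_space set \<Rightarrow> ('a \<Rightarrow> 'b::euclidean_space) \<Rightarrow> ereal" where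
  "Linf_norm S g = esssup (lebesgue_on S) (\<lambda>x. ereal (norm (g x)))"

definition Linf :: "'a::euclidean_space set \<Rightarrow> ('a \<Rightarrow> 'b::euclidean_space) set" where
  "Linf S = {g. g \<in> borel_measurable (lebesgue_on S) \<and> Linf_norm S g < \<infinity>}"

text \<open>Bochner measurability of \<open>t \<mapsto> F t\<close> as a map into \<open>L\<^sup>\<infinity>(S)\<close>: it is almost everywhere the limit,
  in the norm of \<open>L\<^sup>\<infinity>(S)\<close>, of measurable maps with finitely many values.\<close>

definition bochner_measurable_Linf ::
  "real \<Rightarrow> 'a::euclidean_space set \<Rightarrow> (real \<Rightarrow> 'a \<Rightarrow> 'b::euclidean_space) \<Rightarrow> bool" where
  "bochner_measurable_Linf T S F \<longleftrightarrow>
     (\<exists>s::nat \<Rightarrow> real \<Rightarrow> 'a \<Rightarrow> 'b.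
        (\<forall>k. finite (s k ` {0<..<T}) \<and> s k ` {0<..<T} \<subseteq> Linf S \<and>
             (\<forall>g. {t\<in>{0<..<T}. s k t = g} \<in> sets lebesgue)) \<and>
        (AE t in lebesgue_on {0<..<T}.
           (\<lambda>k. Linf_norm S (\<lambda>x. s k t x - F t x)) \<longlonglongrightarrow> 0))"

text \<open>The space \<open>L\<^sup>\<infinity>(0,T;L\<^sup>\<infinity>(S))\<close>. Bochner measurability guarantees a jointly measurable
  representative \<open>(t,x) \<mapsto> F t x\<close>; the first condition says that \<open>F\<close> is one, so that Bochner integrals
  over time can be computed pointwise in \<open>x\<close>.\<close>

definition Linf_Linf ::
  "real \<Rightarrow> 'a::euclidean_space set \<Rightarrow> (real \<Rightarrow> 'a \<Rightarrow> 'b::euclidean_space) set" where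
  "Linf_Linf T S = {F.
     (\<lambda>p. F (fst p) (snd p)) \<in> borel_measurable (lebesgue_on ({0<..<T} \<times> S)) \<and>
     bochner_measurable_Linf T S F \<and>
     (AE t in lebesgue_on {0<..<T}. F t \<in> Linf S) \<and>
     (\<exists>c::real. AE t in lebesgue_on {0<..<T}. Linf_norm S (F t) \<le> ereal c)}"

text \<open>\<open>G\<close> is the weak time derivative of \<open>F\<close>; the defining identity between elements of \<open>L\<^sup>\<infinity>(S)\<close> is
  an identity for almost every \<open>x\<close>.\<close>

definition W1inf_Linf ::
  "real \<Rightarrow> 'a::euclidean_space set \<Rightarrow> (real \<Rightarrow> 'a \<Rightarrow> 'b::euclidean_space) set" where
  "W1inf_Linf T S = {F. F \<in> Linf_Linf T S \<and>
     (\<exists>G\<in>Linf_Linf T S. \<forall>\<phi>::real \<Rightarrow> real. test_function {0<..<T} \<phi> \<longrightarrow>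
        (AE x in lebesgue_on S.
           (LINT t|lebesgue_on {0<..<T}. deriv \<phi> t *\<^sub>R F t x)
             = - (LINT t|lebesgue_on {0<..<T}. \<phi> t *\<^sub>R G t x)))}"


section \<open>Spherical harmonics and the toroidal fields \<open>T\<^sub>l\<^sup>m\<close>\<close>

text \<open>Rodrigues' formula, valid for \<open>-l \<le> m \<le> l\<close>, with the Condon--Shortley phase.\<close>

definition assoc_legendre :: "nat \<Rightarrow> int \<Rightarrow> real \<Rightarrow> real" where
  "assoc_legendre l m z =
     (-1) powi m / (2 ^ l * fact l) * (1 - z\<^sup>2) powr (of_int m / 2) *
     poly ((pderiv ^^ nat (int l + m)) ([:-1, 0, 1:] ^ l)) z"

definition spherical_harmonic :: "nat \<Rightarrow> int \<Rightarrow> real \<Rightarrow> real \<Rightarrow> complex" where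
  "spherical_harmonic l m \<theta> \<phi> =
     of_real (sqrt ((2 * real l + 1) / (4 * pi) *
                    (fact (nat (int l - m)) / fact (nat (int l + m)))) *
              assoc_legendre l m (cos \<theta>)) *
     exp (\<i> * of_int m * of_real \<phi>)"

definition e_r :: "real \<Rightarrow> real \<Rightarrow> real^3" where
  "e_r \<theta> \<phi> = vector [sin \<theta> * cos \<phi>, sin \<theta> * sin \<phi>, cos \<theta>]"

definition e_theta :: "real \<Rightarrow> real \<Rightarrow> real^3" where
  "e_theta \<theta> \<phi> = vector [cos \<theta> * cos \<phi>, cos \<theta> * sin \<phi>, - sin \<theta>]"

definition e_phi :: "real \<Rightarrow> real \<Rightarrow> real^3" where
  "e_phi \<theta> \<phi> = vector [- sin \<phi>, cos \<phi>, 0]"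

definition cvec :: "real^3 \<Rightarrow> complex^3" where
  "cvec v = (\<chi> i. complex_of_real (v $ i))"

definition ccross :: "complex^3 \<Rightarrow> complex^3 \<Rightarrow> complex^3" where
  "ccross a b = vector [a$2 * b$3 - a$3 * b$2, a$3 * b$1 - a$1 * b$3, a$1 * b$2 - a$2 * b$1]"

definition surface_grad :: "(real \<Rightarrow> real \<Rightarrow> complex) \<Rightarrow> real \<Rightarrow> real \<Rightarrow> complex^3" where
  "surface_grad Y \<theta> \<phi> =
     vector_derivative (\<lambda>s. Y s \<phi>) (at \<theta>) *s cvec (e_theta \<theta> \<phi>) +
     (vector_derivative (\<lambda>s. Y \<theta> s) (at \<phi>) / of_real (sin \<theta>)) *s cvec (e_phi \<theta> \<phi>)"

definition toroidal :: "nat \<Rightarrow> int \<Rightarrow> real \<Rightarrow> real \<Rightarrow> complex^3" where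
  "toroidal l m \<theta> \<phi> = ccross (surface_grad (spherical_harmonic l m) \<theta> \<phi>) (cvec (e_r \<theta> \<phi>))"

definition polar_angle :: "real^3 \<Rightarrow> real" where
  "polar_angle x = arccos (x $ 3 / norm x)"

definition azimuth :: "real^3 \<Rightarrow> real" where
  "azimuth x = Arg (Complex (x $ 1) (x $ 2))"

text \<open>The field as a function of position. On the polar axis, a null set, spherical coordinates
  degenerate and the value is meaningless; the jump of \<open>azimuth\<close> at the branch cut is harmless
  because \<open>toroidal l m\<close> has period \<open>2\<pi>\<close> in the second angle.\<close>

definition toroidal_field :: "nat \<Rightarrow> int \<Rightarrow> real^3 \<Rightarrow> complex^3" where
  "toroidal_field l m x = toroidal l m (polar_angle x) (azimuth x)"


section \<open>The discrete space\<close>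

definition X_space :: "real \<Rightarrow> real \<Rightarrow> real \<Rightarrow> nat \<Rightarrow> (real \<Rightarrow> complex) set" where
  "X_space r1 r2 r3 N = {t. isCont t r1 \<and> isCont t r2 \<and>
     (\<forall>I\<in>{{0..r1}, {r1..r2}, {r2..r3}}.
        \<exists>p::complex poly. degree p \<le> N \<and> (\<forall>r\<in>I. t r = poly p (of_real r)))}"

text \<open>The classical curl of \<open>A(r) T\<^sub>l\<^sup>m\<close> exists off the interfaces and the polar axis, so the
  representation of \<open>b\<close> holds almost everywhere. The left-hand side makes the sum real-valued.\<close>

definition V_space_N :: "real \<Rightarrow> real \<Rightarrow> real \<Rightarrow> nat \<Rightarrow> nat \<Rightarrow> (real^3 \<Rightarrow> real^3) set" where
  "V_space_N r1 r2 r3 N M = {b. b \<in> Vspace (ball 0 r3) \<and> weakly_div_free (ball 0 r3) b \<and>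
     (\<exists>t A :: nat \<Rightarrow> int \<Rightarrow> real \<Rightarrow> complex.
        (\<forall>l m. t l m \<in> X_space r1 r2 r3 N \<and> A l m \<in> X_space r1 r2 r3 N) \<and>
        (AE x in lebesgue_on (ball 0 r3).
           cvec (b x) = (\<Sum>l\<le>M. \<Sum>m\<in>{- int l..int l}.
             t l m (norm x) *s toroidal_field l m x +
             curl (\<lambda>y. A l m (norm y) *s toroidal_field l m y) x)))}"

text \<open>Linear projections of \<open>V\<close> onto a subspace \<open>W\<close>, on almost-everywhere classes.\<close>

definition projection_onto ::
  "(real^3) set \<Rightarrow> (real^3 \<Rightarrow> real^3) set \<Rightarrow> ((real^3 \<Rightarrow> real^3) \<Rightarrow> real^3 \<Rightarrow> real^3) \<Rightarrow> bool" where
  "projection_onto S W P \<longleftrightarrow>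
     (\<forall>c\<in>Vspace S. P c \<in> W) \<and>
     (\<forall>c\<in>W. AE x in lebesgue_on S. P c x = c x) \<and>
     (\<forall>c\<in>Vspace S. \<forall>d\<in>Vspace S. (AE x in lebesgue_on S. c x = d x) \<longrightarrow>
        (AE x in lebesgue_on S. P c x = P d x)) \<and>
     (\<forall>c\<in>Vspace S. \<forall>d\<in>Vspace S.
        AE x in lebesgue_on S. P (\<lambda>y. c y + d y) x = P c x + P d x) \<and>
     (\<forall>c\<in>Vspace S. \<forall>k. AE x in lebesgue_on S. P (\<lambda>y. k *\<^sub>R c y) x = k *\<^sub>R P c x)"

text \<open>\<open>[b] = 0\<close> on the sphere of radius \<open>r\<close>: the one-sided limits agree, for a suitable representative
  \<open>g\<close> of \<open>b\<close>.\<close>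

definition no_jump :: "(real^3) set \<Rightarrow> real \<Rightarrow> (real^3 \<Rightarrow> real^3) \<Rightarrow> bool" where
  "no_jump S r b \<longleftrightarrow>
     (\<exists>g. (AE x in lebesgue_on S. g x = b x) \<and>
        (\<forall>x\<in>sphere 0 r. \<exists>v. (g \<longlongrightarrow> v) (at x within {y. norm y < r}) \<and>
                              (g \<longlongrightarrow> v) (at x within {y. norm y > r})))"


section \<open>The fully discrete scheme\<close>

definition time_average ::
  "real \<Rightarrow> (real \<Rightarrow> 'a \<Rightarrow> 'b::{banach, second_countable_topology}) \<Rightarrow> nat \<Rightarrow> 'a \<Rightarrow> 'b" where
  "time_average \<tau> F n x =
     (1 / \<tau>) *\<^sub>R (LINT t|lebesgue_on {real (n - 1) * \<tau>..real n * \<tau>}. F t x)"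

definition diff_quot :: "real \<Rightarrow> (nat \<Rightarrow> 'a \<Rightarrow> 'b::real_vector) \<Rightarrow> nat \<Rightarrow> 'a \<Rightarrow> 'b" where
  "diff_quot \<tau> v n x = (1 / \<tau>) *\<^sub>R (v n x - v (n - 1) x)"

definition scheme_solution ::
  "real \<Rightarrow> real \<Rightarrow> real \<Rightarrow> real \<Rightarrow> real \<Rightarrow> real \<Rightarrow> (real^3 \<Rightarrow> real) \<Rightarrow>
   (real \<Rightarrow> real^3 \<Rightarrow> real) \<Rightarrow> (real \<Rightarrow> real^3 \<Rightarrow> real^3) \<Rightarrow> (real^3 \<Rightarrow> real^3) \<Rightarrow>
   nat \<Rightarrow> nat \<Rightarrow> real \<Rightarrow> nat \<Rightarrow> (nat \<Rightarrow> real^3 \<Rightarrow> real^3) \<Rightarrow> bool" where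
  "scheme_solution r1 r2 r3 R\<alpha> Rm \<sigma> \<beta> f u b_init N M \<tau> K b \<longleftrightarrow>
     (let \<Omega> = ball 0 r3; \<beta>b = beta_bar r1 r2 r3 \<beta> in
      (\<forall>n\<le>K. b n \<in> V_space_N r1 r2 r3 N M) \<and>
      (AE x in lebesgue_on \<Omega>. b 0 x = b_init x) \<and>
      (\<forall>n\<in>{1..K}.
         no_jump \<Omega> r1 (b n) \<and> no_jump \<Omega> r2 (b n) \<and>
         (\<forall>a\<in>V_space_N r1 r2 r3 N M.
            (LINT x|lebesgue_on \<Omega>. diff_quot \<tau> b n x \<bullet> a x) +
            (LINT x|lebesgue_on \<Omega>. \<beta>b x * (weak_curl \<Omega> (b n) x \<bullet> weak_curl \<Omega> a x))
            = (LINT x|lebesgue_on \<Omega>.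
                 (\<beta>b x - \<beta> x) * (weak_curl \<Omega> (b (n - 1)) x \<bullet> weak_curl \<Omega> a x)) +
              R\<alpha> * (LINT x|lebesgue_on \<Omega>.
                 (time_average \<tau> f n x / (1 + \<sigma> * (norm (b (n - 1) x))\<^sup>2)) *
                 (b (n - 1) x \<bullet> weak_curl \<Omega> a x)) +
              Rm * (LINT x|lebesgue_on \<Omega>.
                 cross3 (time_average \<tau> u n x) (b (n - 1) x) \<bullet> weak_curl \<Omega> a x))))"

end

theory Submission
  imports Defs
begin

text \<open>
  Both estimates are discrete energy estimates with constants that depend only on the bounds of the
  coefficients and on \<open>T\<close>. They do not depend on the polynomial degrees, because the scheme is tested
  with \<open>b\<^sub>n\<close> and \<open>b\<^sub>n\<^sub>-\<^sub>1\<close>, which lie in the discrete space whatever the degrees are. Write \<open>F\<^sub>n\<close> for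
  the source, which is explicit and satisfies \<open>|F\<^sub>n| \<le> c |b\<^sub>n\<^sub>-\<^sub>1|\<close>.

  For the first estimate, test with \<open>b\<^sub>n\<close>. The diffusion is split into an implicit part with the coefficient
  \<open>\<beta>b\<close> and a lagged part with \<open>\<beta>b - \<beta> \<ge> 0\<close>. The lagged part is a nonnegative quadratic form, so the elementary
  inequality \<open>2 v \<bullet> w \<le> |v|\<^sup>2 + |w|\<^sup>2\<close> makes it telescope when \<open>\<tau>\<close> times its value is added to the
  energy. The dissipation with coefficient \<open>\<beta> \<ge> \<beta>1\<close> remains, absorbs the source, and Gronwall's
  lemma concludes (\<open>energy_step\<close>, \<open>energy_estimate\<close>). The initial value of this modified energy is the
  origin of the term \<open>\<tau>\<close> times the squared norm of the initial curl.

  For the second estimate, take the difference of the equations tested with \<open>b\<^sub>n\<close> and \<open>b\<^sub>n\<^sub>-\<^sub>1\<close>. Since \<open>2 \<beta>b \<ge> \<beta>\<close>,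
  the diffusion controls the increments of the curl energy with weight \<open>\<beta>\<close> (\<open>dissipation_step\<close>). The source
  is then tested with increments of the curl, for which there is no bound; summation by parts moves
  the difference onto the source. Its increments are controlled by \<open>\<tau> |b\<^sub>n|\<close> and \<open>|b\<^sub>n - b\<^sub>n\<^sub>-\<^sub>1|\<close>: the first
  contribution is handled by the first estimate and the second one is absorbed
  (\<open>dissipation_estimate\<close>).

  That the source increments have this form needs two facts. The quenched field depends
  Lipschitz-continuously on the field (\<open>quench_Lipschitz\<close>), and consecutive time averages of \<open>f\<close> and \<open>u\<close> differ by
  at most a multiple of \<open>\<tau>\<close> at almost every point (\<open>time_average_bounds\<close>). The latter is where the
  \<open>W\<^sup>1\<^sup>,\<^sup>\<infinity>\<close> regularity is used: the weak derivative is applied to smooth test functions whose derivatives approximate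
  the difference of the indicator functions of two consecutive time steps.
\<close>


section \<open>Square-integrable functions and discrete inequalities\<close>

definition square_integrable :: "'a measure \<Rightarrow> ('a \<Rightarrow> 'b::euclidean_space) \<Rightarrow> bool" where
  "square_integrable M f \<longleftrightarrow> f \<in> borel_measurable M \<and> integrable M (\<lambda>x. (norm (f x))\<^sup>2)"

lemma square_integrable_bounded_mult:
  assumes "square_integrable M f" "square_integrable M g"
    and [measurable]: "h \<in> borel_measurable M" and "AE x in M. \<bar>h x\<bar> \<le> C"
  shows "integrable M (\<lambda>x. h x * (f x \<bullet> g x))"
proof (rule Bochner_Integration.integrable_bound)
  have [measurable]: "f \<in> borel_measurable M" "g \<in> borel_measurable M"
    using assms by (auto simp: square_integrable_def)
  show "integrable M (\<lambda>x. C * ((norm (f x))\<^sup>2 + (norm (g x))\<^sup>2))"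
    using assms by (auto simp: square_integrable_def)
  show "(\<lambda>x. h x * (f x \<bullet> g x)) \<in> borel_measurable M" by measurable
  show "AE x in M. norm (h x * (f x \<bullet> g x)) \<le> norm (C * ((norm (f x))\<^sup>2 + (norm (g x))\<^sup>2))"
    using assms(4)
  proof eventually_elim
    case (elim x)
    have "\<bar>f x \<bullet> g x\<bar> \<le> norm (f x) * norm (g x)" by (rule Cauchy_Schwarz_ineq2)
    also have "\<dots> \<le> (norm (f x))\<^sup>2 + (norm (g x))\<^sup>2"
      using sum_squares_bound[of "norm (f x)" "norm (g x)"]
        mult_nonneg_nonneg[OF norm_ge_zero norm_ge_zero, of "f x" "g x"]
      by linarith
    finally have "\<bar>h x\<bar> * \<bar>f x \<bullet> g x\<bar> \<le> \<bar>C\<bar> * ((norm (f x))\<^sup>2 + (norm (g x))\<^sup>2)"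
      using elim by (intro mult_mono) auto
    then show ?case by (simp add: abs_mult abs_of_nonneg)
  qed
qed

lemma square_integrable_inner:
  assumes "square_integrable M f" "square_integrable M g"
  shows "integrable M (\<lambda>x. f x \<bullet> g x)"
  using square_integrable_bounded_mult[OF assms, of "\<lambda>x. 1" 1] by simp

lemma square_integrable_dominated:
  assumes "square_integrable M f" and [measurable]: "g \<in> borel_measurable M"
    and "AE x in M. norm (g x) \<le> c * norm (f x)"
  shows "square_integrable M g"
  unfolding square_integrable_def
proof
  show "integrable M (\<lambda>x. (norm (g x))\<^sup>2)"
  proof (rule Bochner_Integration.integrable_bound)
    show "integrable M (\<lambda>x. c\<^sup>2 * (norm (f x))\<^sup>2)"
      using assms(1) by (auto simp: square_integrable_def)
    show "AE x in M. norm ((norm (g x))\<^sup>2) \<le> norm (c\<^sup>2 * (norm (f x))\<^sup>2)"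
      using assms(3)
      by eventually_elim (simp add: power_mult_distrib[symmetric] power_mono)
  qed measurable
qed (fact assms)

lemma square_integrable_diff:
  assumes "square_integrable M f" "square_integrable M g"
  shows "square_integrable M (\<lambda>x. f x - g x)"
proof -
  have [measurable]: "f \<in> borel_measurable M" "g \<in> borel_measurable M"
    using assms by (auto simp: square_integrable_def)
  have "integrable M (\<lambda>x. (norm (f x))\<^sup>2 + (norm (g x))\<^sup>2 - 2 * (f x \<bullet> g x))"
    using assms square_integrable_inner[OF assms] by (auto simp: square_integrable_def)
  also have "(\<lambda>x. (norm (f x))\<^sup>2 + (norm (g x))\<^sup>2 - 2 * (f x \<bullet> g x)) = (\<lambda>x. (norm (f x - g x))\<^sup>2)"
    by (auto simp: power2_norm_eq_inner inner_diff inner_commute algebra_simps)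
  finally show ?thesis by (simp add: square_integrable_def)
qed

lemma Young_norm:
  fixes a b :: "'b::real_inner" and e :: real
  assumes "0 < e"
  shows "2 * (a \<bullet> b) \<le> (norm a)\<^sup>2 / e + e * (norm b)\<^sup>2"
proof -
  have "0 \<le> (norm (a - e *\<^sub>R b))\<^sup>2 / e" using assms by simp
  also have "\<dots> = (norm a)\<^sup>2 / e + e * (norm b)\<^sup>2 - 2 * (a \<bullet> b)"
    using assms by (simp add: power2_norm_eq_inner inner_diff inner_commute field_simps)
  finally show ?thesis by simp
qed

text \<open>The terms \<open>P n\<close> are carried along with \<open>E\<close>: since \<open>1 \<le> 1 + q\<close>, amplifying the part of the sum
  that has already been collected only makes the right-hand side larger.\<close>

lemma discrete_Gronwall:
  fixes E P :: "nat \<Rightarrow> real"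
  assumes step: "\<And>n. n < k \<Longrightarrow> E (Suc n) + P (Suc n) \<le> (1 + q) * E n"
    and "\<And>n. 0 \<le> P n" "0 \<le> q"
  shows "E k + (\<Sum>n=1..k. P n) \<le> (1 + q) ^ k * E 0"
  using step
proof (induction k)
  case (Suc k)
  have "E (Suc k) + (\<Sum>n=1..Suc k. P n) \<le> (1 + q) * E k + (\<Sum>n=1..k. P n)"
    using Suc.prems[of k] by simp
  also have "\<dots> \<le> (1 + q) * (E k + (\<Sum>n=1..k. P n))"
    using assms(2,3) by (simp add: algebra_simps sum_nonneg)
  also have "\<dots> \<le> (1 + q) * ((1 + q) ^ k * E 0)"
    using Suc.IH Suc.prems assms(3) by (intro mult_left_mono) auto
  finally show ?case by (simp add: algebra_simps)
qed simp

text \<open>Moves the difference from the second index to the first one. In the application \<open>G n m\<close> is the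
  source of step \<open>n\<close> tested with the curl of step \<open>m\<close>: increments of the curls cannot be estimated,
  increments of the sources can.\<close>

lemma summation_by_parts:
  fixes G :: "nat \<Rightarrow> nat \<Rightarrow> real"
  shows "(\<Sum>n=1..Suc k. G n n - G n (n - 1))
       = G (Suc k) (Suc k) - G 1 0 + (\<Sum>n=1..k. G n n - G (Suc n) n)"
proof (induction k)
  case (Suc k)
  have "(\<Sum>n=1..Suc (Suc k). G n n - G n (n - 1))
      = (\<Sum>n=1..Suc k. G n n - G n (n - 1)) + (G (Suc (Suc k)) (Suc (Suc k)) - G (Suc (Suc k)) (Suc k))"
    by (subst sum.cl_ivl_Suc) simp
  then show ?case using Suc by simp
qed simp

section \<open>Energy estimates for schemes with lagged diffusion\<close>

text \<open>The exponential is Gronwall's bound for \<open>(1 + \<tau> c\<^sup>2 / \<beta>1) ^ K\<close>; the factor \<open>1 + \<beta>2\<close> bounds the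
  initial energy, whose lagged part carries the weight \<open>\<beta>b - \<beta> \<le> \<beta>2\<close>.\<close>

definition energy_const :: "real \<Rightarrow> real \<Rightarrow> real \<Rightarrow> real \<Rightarrow> real" where
  "energy_const \<beta>1 \<beta>2 c T = exp (c\<^sup>2 / \<beta>1 * T) * (1 + \<beta>2)"

text \<open>The first summand collects what the initial data contribute directly, the second one the terms
  controlled by the energy estimate; \<open>1 + T\<close> absorbs the factor in \<open>B 0 + \<tau> * W 0 \<le> (1 + T) * (B 0 + W 0)\<close>.\<close>

definition dissipation_const :: "real \<Rightarrow> real \<Rightarrow> real \<Rightarrow> real \<Rightarrow> real" where
  "dissipation_const \<beta>1 \<beta>2 c T =
     (1 + \<beta>2 + c\<^sup>2) + (2 * c\<^sup>2 / \<beta>1 + c * T + (c + c\<^sup>2) / \<beta>1) * (energy_const \<beta>1 \<beta>2 c T * (1 + T))"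

text \<open>The structure of the scheme with the differential operators removed: \<open>w n\<close> stands for the curl of
  \<open>b n\<close>, and \<open>F n\<close> for the source term of step \<open>n\<close>, which is explicit and therefore bounded by the
  field of step \<open>n - 1\<close>. The equation tested with \<open>b n\<close> carries the energy estimate; its difference with
  the equation tested with \<open>b (n - 1)\<close> carries the dissipation estimate.\<close>

locale lagged_diffusion_scheme =
  fixes M :: "'a measure" and b w F :: "nat \<Rightarrow> 'a \<Rightarrow> 'b::euclidean_space"
    and \<beta> \<beta>b :: "'a \<Rightarrow> real" and \<beta>1 \<beta>2 c T \<tau> :: real and K :: nat
  assumes \<beta>1_pos: "0 < \<beta>1" and c_nonneg: "0 \<le> c" and T_pos: "0 < T"
    and K_pos: "0 < K" and \<tau>_eq: "\<tau> = T / real K"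
    and \<beta>_measurable: "\<beta> \<in> borel_measurable M" and \<beta>b_measurable: "\<beta>b \<in> borel_measurable M"
    and \<beta>_bounds: "AE x in M. \<beta>1 \<le> \<beta> x \<and> \<beta> x \<le> \<beta>b x \<and> \<beta>b x \<le> \<beta>2"
    and b_L2: "n \<le> K \<Longrightarrow> square_integrable M (b n)"
    and w_L2: "n \<le> K \<Longrightarrow> square_integrable M (w n)"
    and F_measurable: "n \<in> {1..K} \<Longrightarrow> F n \<in> borel_measurable M"
    and F_bound: "n \<in> {1..K} \<Longrightarrow> AE x in M. norm (F n x) \<le> c * norm (b (n - 1) x)"
    and F_increment: "n \<in> {1..<K} \<Longrightarrow> AE x in M.
          norm (F (Suc n) x - F n x) \<le> c * (\<tau> * norm (b n x) + norm (b n x - b (n - 1) x))"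
    and scheme: "\<lbrakk>n \<in> {1..K}; m \<in> {n - 1, n}\<rbrakk> \<Longrightarrow>
          (1 / \<tau>) * (LINT x|M. (b n x - b (n - 1) x) \<bullet> b m x) + (LINT x|M. \<beta>b x * (w n x \<bullet> w m x))
          = (LINT x|M. (\<beta>b x - \<beta> x) * (w (n - 1) x \<bullet> w m x)) + (LINT x|M. F n x \<bullet> w m x)"
begin

text \<open>The quantity \<open>\<tau> * Q n\<close> is the energy that the lagged diffusion carries over to the next step.\<close>

definition B :: "nat \<Rightarrow> real" where "B n = (LINT x|M. b n x \<bullet> b n x)"
definition W :: "nat \<Rightarrow> real" where "W n = (LINT x|M. w n x \<bullet> w n x)"
definition D :: "nat \<Rightarrow> real" where
  "D n = (LINT x|M. (b n x - b (n - 1) x) \<bullet> (b n x - b (n - 1) x))"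
definition P :: "nat \<Rightarrow> real" where "P n = (LINT x|M. \<beta> x * (w n x \<bullet> w n x))"
definition Q :: "nat \<Rightarrow> real" where "Q n = (LINT x|M. (\<beta>b x - \<beta> x) * (w n x \<bullet> w n x))"
definition G :: "nat \<Rightarrow> nat \<Rightarrow> real" where "G n m = (LINT x|M. F n x \<bullet> w m x)"

lemma \<tau>_pos: "0 < \<tau>" and \<tau>_le_T: "\<tau> \<le> T" and K_\<tau>: "real K * \<tau> = T"
  using T_pos K_pos by (auto simp: \<tau>_eq field_simps)

lemma F_L2: "n \<in> {1..K} \<Longrightarrow> square_integrable M (F n)"
  using square_integrable_dominated[OF b_L2[of "n - 1"] F_measurable[of n] F_bound[of n]] by auto

lemma integrable_coefficients:
  assumes "n \<le> K" "m \<le> K"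
  shows "integrable M (\<lambda>x. \<beta> x * (w n x \<bullet> w m x))"
    and "integrable M (\<lambda>x. \<beta>b x * (w n x \<bullet> w m x))"
    and "integrable M (\<lambda>x. (\<beta>b x - \<beta> x) * (w n x \<bullet> w m x))"
proof -
  note [measurable] = \<beta>_measurable \<beta>b_measurable
  show "integrable M (\<lambda>x. \<beta> x * (w n x \<bullet> w m x))"
    using \<beta>_bounds \<beta>1_pos
    by (intro square_integrable_bounded_mult[OF w_L2 w_L2, where C = \<beta>2] assms) auto
  show "integrable M (\<lambda>x. \<beta>b x * (w n x \<bullet> w m x))"
    using \<beta>_bounds \<beta>1_pos
    by (intro square_integrable_bounded_mult[OF w_L2 w_L2, where C = \<beta>2] assms) auto
  show "integrable M (\<lambda>x. (\<beta>b x - \<beta> x) * (w n x \<bullet> w m x))"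
    using \<beta>_bounds \<beta>1_pos
    by (intro square_integrable_bounded_mult[OF w_L2 w_L2, where C = \<beta>2] assms) auto
qed

lemmas integrable_fields =
  square_integrable_inner[OF b_L2 b_L2] square_integrable_inner[OF w_L2 w_L2]
  square_integrable_inner[OF square_integrable_diff[OF b_L2 b_L2] b_L2]
  square_integrable_inner[OF square_integrable_diff[OF b_L2 b_L2] square_integrable_diff[OF b_L2 b_L2]]
  square_integrable_inner[OF F_L2 w_L2]

lemma nonneg: "0 \<le> B n" "0 \<le> W n" "0 \<le> D n"
  by (simp_all add: B_def W_def D_def)

lemma Q_nonneg: "0 \<le> Q n"
  unfolding Q_def using \<beta>_bounds by (intro integral_nonneg_AE) auto

lemma P_lower: "n \<le> K \<Longrightarrow> \<beta>1 * W n \<le> P n"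
proof -
  assume n: "n \<le> K"
  have "(LINT x|M. \<beta>1 * (w n x \<bullet> w n x)) \<le> P n"
    unfolding P_def using \<beta>_bounds n
    by (intro integral_mono_AE integrable_coefficients integrable_mult_right integrable_fields)
      (auto intro!: mult_right_mono)
  then show ?thesis by (simp add: W_def)
qed

lemma weighted_upper: "n \<le> K \<Longrightarrow> P n \<le> \<beta>2 * W n" "n \<le> K \<Longrightarrow> Q n \<le> \<beta>2 * W n"
proof -
  assume n: "n \<le> K"
  have "P n \<le> (LINT x|M. \<beta>2 * (w n x \<bullet> w n x))"
    unfolding P_def using \<beta>_bounds n
    by (intro integral_mono_AE integrable_coefficients integrable_mult_right integrable_fields)
      (auto intro!: mult_right_mono)
  then show "P n \<le> \<beta>2 * W n" by (simp add: W_def)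
  have "Q n \<le> (LINT x|M. \<beta>2 * (w n x \<bullet> w n x))"
    unfolding Q_def using \<beta>_bounds \<beta>1_pos n
    by (intro integral_mono_AE integrable_coefficients integrable_mult_right integrable_fields)
      (auto intro!: mult_right_mono)
  then show "Q n \<le> \<beta>2 * W n" by (simp add: W_def)
qed

lemma F_norm_sq:
  assumes "n \<in> {1..K}"
  shows "AE x in M. (norm (F n x))\<^sup>2 \<le> c\<^sup>2 * (b (n - 1) x \<bullet> b (n - 1) x)"
  using F_bound[OF assms]
proof eventually_elim
  case (elim x)
  then have "(norm (F n x))\<^sup>2 \<le> (c * norm (b (n - 1) x))\<^sup>2"
    by (intro power_mono) auto
  then show ?case by (simp add: power_mult_distrib power2_norm_eq_inner)
qed

lemma G_bound:
  assumes n: "n \<in> {1..K}" and m: "m \<le> K" and e: "0 < e"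
  shows "2 * \<bar>G n m\<bar> \<le> c\<^sup>2 / e * B (n - 1) + e * W m"
proof -
  have "2 * \<bar>G n m\<bar> \<le> 2 * (LINT x|M. \<bar>F n x \<bullet> w m x\<bar>)"
    unfolding G_def by simp
  also have "\<dots> = (LINT x|M. 2 * \<bar>F n x \<bullet> w m x\<bar>)" by simp
  also have "\<dots> \<le> (LINT x|M. c\<^sup>2 / e * (b (n - 1) x \<bullet> b (n - 1) x) + e * (w m x \<bullet> w m x))"
  proof (rule integral_mono_AE)
    show "integrable M (\<lambda>x. 2 * \<bar>F n x \<bullet> w m x\<bar>)"
      using integrable_fields(5)[OF n m] by (intro integrable_mult_right integrable_abs)
    show "integrable M (\<lambda>x. c\<^sup>2 / e * (b (n - 1) x \<bullet> b (n - 1) x) + e * (w m x \<bullet> w m x))"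
      using n m by (intro integrable_mult_right Bochner_Integration.integrable_add integrable_fields) auto
    show "AE x in M. 2 * \<bar>F n x \<bullet> w m x\<bar> \<le> c\<^sup>2 / e * (b (n - 1) x \<bullet> b (n - 1) x) + e * (w m x \<bullet> w m x)"
      using F_norm_sq[OF n]
    proof eventually_elim
      case (elim x)
      have "2 * \<bar>F n x \<bullet> w m x\<bar> \<le> (norm (F n x))\<^sup>2 / e + e * (norm (w m x))\<^sup>2"
        using Young_norm[OF e, of "F n x" "w m x"] Young_norm[OF e, of "- F n x" "w m x"]
        by (simp add: abs_if)
      also have "(norm (F n x))\<^sup>2 / e \<le> c\<^sup>2 * (b (n - 1) x \<bullet> b (n - 1) x) / e"
        using elim e by (intro divide_right_mono) auto
      finally show ?case by (simp add: power2_norm_eq_inner)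
    qed
  qed
  also have "\<dots> = c\<^sup>2 / e * B (n - 1) + e * W m"
    unfolding B_def W_def using n m
    by (subst Bochner_Integration.integral_add)
      (auto intro!: integrable_mult_right integrable_fields)
  finally show ?thesis .
qed

text \<open>Test with \<open>b n\<close> and double the equation. The implicit diffusion yields \<open>2 (P n + Q n)\<close>. As the
  weight \<open>\<beta>b - \<beta>\<close> is nonnegative, the lagged diffusion is at most \<open>Q (n - 1) + Q n\<close>, so that the \<open>Q\<close> telescope and the dissipation
  \<open>2 P n\<close> survives in full. Half of it pays for the source.\<close>

lemma energy_step:
  assumes n: "n \<in> {1..K}"
  shows "B n + \<tau> * Q n + \<beta>1 * \<tau> * W n \<le> (1 + c\<^sup>2 / \<beta>1 * \<tau>) * (B (n - 1) + \<tau> * Q (n - 1))"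
proof -
  have le: "n \<le> K" "n - 1 \<le> K" using n by auto
  have "B n - B (n - 1) = (LINT x|M. b n x \<bullet> b n x - b (n - 1) x \<bullet> b (n - 1) x)"
    unfolding B_def using le
    by (subst Bochner_Integration.integral_diff) (auto intro!: integrable_fields)
  also have "\<dots> \<le> (LINT x|M. 2 * ((b n x - b (n - 1) x) \<bullet> b n x))"
  proof (intro integral_mono)
    fix x
    have "0 \<le> (b n x - b (n - 1) x) \<bullet> (b n x - b (n - 1) x)" by simp
    then show "b n x \<bullet> b n x - b (n - 1) x \<bullet> b (n - 1) x \<le> 2 * ((b n x - b (n - 1) x) \<bullet> b n x)"
      by (simp add: inner_diff inner_commute)
  qed (use le in \<open>auto intro!: integrable_fields\<close>)
  finally have time: "B n - B (n - 1) \<le> 2 * (LINT x|M. (b n x - b (n - 1) x) \<bullet> b n x)" by simp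
  have split: "(LINT x|M. \<beta>b x * (w n x \<bullet> w n x)) = Q n + P n"
    unfolding P_def Q_def using le
    by (subst Bochner_Integration.integral_add[symmetric])
      (auto intro!: integrable_coefficients simp: algebra_simps)
  have "2 * (LINT x|M. (\<beta>b x - \<beta> x) * (w (n - 1) x \<bullet> w n x))
      = (LINT x|M. 2 * ((\<beta>b x - \<beta> x) * (w (n - 1) x \<bullet> w n x)))" by simp
  also have "\<dots> \<le> (LINT x|M. (\<beta>b x - \<beta> x) * (w (n - 1) x \<bullet> w (n - 1) x) + (\<beta>b x - \<beta> x) * (w n x \<bullet> w n x))"
  proof (intro integral_mono_AE)
    show "AE x in M. 2 * ((\<beta>b x - \<beta> x) * (w (n - 1) x \<bullet> w n x))
        \<le> (\<beta>b x - \<beta> x) * (w (n - 1) x \<bullet> w (n - 1) x) + (\<beta>b x - \<beta> x) * (w n x \<bullet> w n x)"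
      using \<beta>_bounds
    proof eventually_elim
      case (elim x)
      have "(\<beta>b x - \<beta> x) * (2 * (w (n - 1) x \<bullet> w n x))
          \<le> (\<beta>b x - \<beta> x) * (w (n - 1) x \<bullet> w (n - 1) x + w n x \<bullet> w n x)"
        using Young_norm[of 1 "w (n - 1) x" "w n x"] elim
        by (intro mult_left_mono) (auto simp: power2_norm_eq_inner)
      then show ?case by (simp add: algebra_simps)
    qed
  qed (use le in \<open>auto intro!: integrable_coefficients\<close>)
  also have "\<dots> = Q (n - 1) + Q n"
    unfolding Q_def using le
    by (subst Bochner_Integration.integral_add) (auto intro!: integrable_coefficients)
  finally have lagged: "2 * (LINT x|M. (\<beta>b x - \<beta> x) * (w (n - 1) x \<bullet> w n x)) \<le> Q (n - 1) + Q n" .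
  have eq: "(LINT x|M. (b n x - b (n - 1) x) \<bullet> b n x)
      = \<tau> * ((LINT x|M. (\<beta>b x - \<beta> x) * (w (n - 1) x \<bullet> w n x)) + G n n - (Q n + P n))"
    using scheme[OF n, of n] \<tau>_pos unfolding split G_def[symmetric] by (simp add: field_simps)
  have "2 * G n n \<le> c\<^sup>2 / \<beta>1 * B (n - 1) + \<beta>1 * W n"
    using G_bound[OF n le(1) \<beta>1_pos] by linarith
  then have "2 * (LINT x|M. (\<beta>b x - \<beta> x) * (w (n - 1) x \<bullet> w n x)) + 2 * G n n - 2 * (Q n + P n)
      \<le> Q (n - 1) - Q n + c\<^sup>2 / \<beta>1 * B (n - 1) - \<beta>1 * W n"
    using lagged P_lower[OF le(1)] by (simp only: distrib_left right_diff_distrib)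
  then have "\<tau> * (2 * (LINT x|M. (\<beta>b x - \<beta> x) * (w (n - 1) x \<bullet> w n x)) + 2 * G n n - 2 * (Q n + P n))
      \<le> \<tau> * (Q (n - 1) - Q n + c\<^sup>2 / \<beta>1 * B (n - 1) - \<beta>1 * W n)"
    using \<tau>_pos by (intro mult_left_mono) auto
  then have "B n - B (n - 1) \<le> \<tau> * (Q (n - 1) - Q n + c\<^sup>2 / \<beta>1 * B (n - 1) - \<beta>1 * W n)"
    using time unfolding eq by (simp add: algebra_simps)
  moreover have "0 \<le> c\<^sup>2 / \<beta>1 * \<tau> * (\<tau> * Q (n - 1))"
    using \<beta>1_pos \<tau>_pos Q_nonneg by (intro mult_nonneg_nonneg) auto
  ultimately show ?thesis by (simp add: algebra_simps)
qed

lemma energy_estimate: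
  assumes k: "k \<le> K" and \<beta>2: "0 \<le> \<beta>2"
  shows "B k + \<beta>1 * (\<tau> * (\<Sum>n=1..k. W n)) \<le> energy_const \<beta>1 \<beta>2 c T * (B 0 + \<tau> * W 0)"
proof -
  define q where "q = c\<^sup>2 / \<beta>1 * \<tau>"
  have q: "0 \<le> q" using \<beta>1_pos \<tau>_pos by (simp add: q_def)
  have "(B k + \<tau> * Q k) + (\<Sum>n=1..k. \<beta>1 * \<tau> * W n) \<le> (1 + q) ^ k * (B 0 + \<tau> * Q 0)"
  proof (rule discrete_Gronwall)
    show "(B (Suc n) + \<tau> * Q (Suc n)) + \<beta>1 * \<tau> * W (Suc n) \<le> (1 + q) * (B n + \<tau> * Q n)" if "n < k" for n
      using energy_step[of "Suc n"] that k by (simp add: q_def)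
  qed (use q \<beta>1_pos \<tau>_pos nonneg in auto)
  also have "\<dots> \<le> exp (c\<^sup>2 / \<beta>1 * T) * ((1 + \<beta>2) * (B 0 + \<tau> * W 0))"
  proof (rule mult_mono)
    have "(1 + q) ^ k \<le> (1 + q) ^ K" using q k by (intro power_increasing) auto
    also have "\<dots> \<le> exp q ^ K" using q exp_ge_add_one_self by (intro power_mono) auto
    also have "\<dots> = exp (c\<^sup>2 / \<beta>1 * (real K * \<tau>))" by (simp add: q_def exp_of_nat_mult[symmetric] algebra_simps)
    finally show "(1 + q) ^ k \<le> exp (c\<^sup>2 / \<beta>1 * T)" by (simp add: K_\<tau>)
    have "\<tau> * Q 0 \<le> \<tau> * (\<beta>2 * W 0)"
      using weighted_upper(2)[of 0] \<tau>_pos by (intro mult_left_mono) auto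
    moreover have "0 \<le> \<tau> * W 0" "0 \<le> \<beta>2 * B 0" using \<tau>_pos \<beta>2 nonneg by simp_all
    ultimately show "B 0 + \<tau> * Q 0 \<le> (1 + \<beta>2) * (B 0 + \<tau> * W 0)"
      by (simp add: algebra_simps)
    show "0 \<le> B 0 + \<tau> * Q 0" using \<tau>_pos Q_nonneg nonneg by simp
  qed simp
  finally show ?thesis
    using \<tau>_pos mult_nonneg_nonneg[OF less_imp_le[OF \<tau>_pos] Q_nonneg[of k]]
    by (simp add: energy_const_def sum_distrib_left mult.assoc)
qed

text \<open>Subtract the equations tested with \<open>b n\<close> and \<open>b (n - 1)\<close>. With \<open>d = w n - w (n - 1)\<close> the two diffusion
  terms combine to \<open>\<beta>b |d|\<^sup>2 + \<beta> w (n - 1) \<bullet> d\<close>, and the polarisation identity turns the second summand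
  into half of \<open>\<beta> |w n|\<^sup>2 - \<beta> |w (n - 1)|\<^sup>2 - \<beta> |d|\<^sup>2\<close>. What remains, \<open>(\<beta>b - \<beta> / 2) |d|\<^sup>2\<close>, is nonnegative.\<close>

lemma dissipation_step:
  assumes n: "n \<in> {1..K}"
  shows "(2 / \<tau>) * D n + P n - P (n - 1) \<le> 2 * (G n n - G n (n - 1))"
proof -
  have le: "n \<le> K" "n - 1 \<le> K" using n by auto
  let ?a = "\<lambda>m. LINT x|M. \<beta>b x * (w n x \<bullet> w m x)"
  let ?l = "\<lambda>m. LINT x|M. (\<beta>b x - \<beta> x) * (w (n - 1) x \<bullet> w m x)"
  let ?d = "\<lambda>m. LINT x|M. (b n x - b (n - 1) x) \<bullet> b m x"
  have D: "D n = ?d n - ?d (n - 1)"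
    unfolding D_def using le
    by (subst Bochner_Integration.integral_diff[symmetric])
      (auto intro!: integrable_fields simp: inner_diff_right)
  have "P n - P (n - 1) = (LINT x|M. \<beta> x * (w n x \<bullet> w n x) - \<beta> x * (w (n - 1) x \<bullet> w (n - 1) x))"
    unfolding P_def using le
    by (subst Bochner_Integration.integral_diff) (auto intro!: integrable_coefficients)
  also have "\<dots> \<le> (LINT x|M. 2 * ((\<beta>b x * (w n x \<bullet> w n x) - \<beta>b x * (w n x \<bullet> w (n - 1) x))
      - ((\<beta>b x - \<beta> x) * (w (n - 1) x \<bullet> w n x) - (\<beta>b x - \<beta> x) * (w (n - 1) x \<bullet> w (n - 1) x))))"
  proof (intro integral_mono_AE)
    show "AE x in M. \<beta> x * (w n x \<bullet> w n x) - \<beta> x * (w (n - 1) x \<bullet> w (n - 1) x)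
      \<le> 2 * ((\<beta>b x * (w n x \<bullet> w n x) - \<beta>b x * (w n x \<bullet> w (n - 1) x))
      - ((\<beta>b x - \<beta> x) * (w (n - 1) x \<bullet> w n x) - (\<beta>b x - \<beta> x) * (w (n - 1) x \<bullet> w (n - 1) x)))"
      using \<beta>_bounds
    proof eventually_elim
      case (elim x)
      \<comment> \<open>Twice the nonnegative remainder of the polarisation identity.\<close>
      have "0 \<le> (2 * \<beta>b x - \<beta> x) * ((w n x - w (n - 1) x) \<bullet> (w n x - w (n - 1) x))"
        using elim \<beta>1_pos by (intro mult_nonneg_nonneg) auto
      then show ?case by (simp add: inner_diff inner_commute algebra_simps)
    qed
  qed (use le in \<open>auto intro!: integrable_coefficients Bochner_Integration.integrable_diff integrable_mult_right\<close>)
  also have "\<dots> = 2 * ((?a n - ?a (n - 1)) - (?l n - ?l (n - 1)))"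
    using le by (simp add: integrable_coefficients)
  finally have "P n - P (n - 1) \<le> 2 * ((?a n - ?a (n - 1)) - (?l n - ?l (n - 1)))" .
  moreover have "(1 / \<tau>) * D n + (?a n - ?a (n - 1)) = (?l n - ?l (n - 1)) + (G n n - G n (n - 1))"
    using scheme[OF n, of n] scheme[OF n, of "n - 1"]
    unfolding D G_def[symmetric] by (simp add: algebra_simps)
  ultimately show ?thesis by simp
qed

text \<open>The part of the source increment that is caused by \<open>b n - b (n - 1)\<close> costs one half of the
  term \<open>(2 / \<tau>) * D n\<close> available from the dissipation step; the rest has a factor \<open>\<tau>\<close> and is summable.\<close>

lemma G_increment:
  assumes n: "n \<in> {1..<K}"
  shows "2 * (G n n - G (Suc n) n) \<le> c * \<tau> * (B n + W n) + (1 / \<tau>) * D n + c\<^sup>2 * \<tau> * W n"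
proof -
  have le: "n \<le> K" "n - 1 \<le> K" "n \<in> {1..K}" "Suc n \<in> {1..K}" using n by auto
  have "2 * (G n n - G (Suc n) n) = (LINT x|M. 2 * (F n x \<bullet> w n x - F (Suc n) x \<bullet> w n x))"
    unfolding G_def using le by (simp add: integrable_fields)
  also have "\<dots> \<le> (LINT x|M. c * \<tau> * (b n x \<bullet> b n x + w n x \<bullet> w n x)
      + ((1 / \<tau>) * ((b n x - b (n - 1) x) \<bullet> (b n x - b (n - 1) x)) + c\<^sup>2 * \<tau> * (w n x \<bullet> w n x)))"
  proof (intro integral_mono_AE)
    show "AE x in M. 2 * (F n x \<bullet> w n x - F (Suc n) x \<bullet> w n x)
        \<le> c * \<tau> * (b n x \<bullet> b n x + w n x \<bullet> w n x)
        + ((1 / \<tau>) * ((b n x - b (n - 1) x) \<bullet> (b n x - b (n - 1) x)) + c\<^sup>2 * \<tau> * (w n x \<bullet> w n x))"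
      using F_increment[OF n]
    proof eventually_elim
      case (elim x)
      define p where "p = norm (b n x)"
      define d where "d = norm (b n x - b (n - 1) x)"
      define v where "v = norm (w n x)"
      have "F n x \<bullet> w n x - F (Suc n) x \<bullet> w n x = (F n x - F (Suc n) x) \<bullet> w n x"
        by (simp add: inner_diff_left)
      also have "\<dots> \<le> norm (F n x - F (Suc n) x) * v"
        unfolding v_def by (rule norm_cauchy_schwarz)
      also have "\<dots> \<le> (c * (\<tau> * p + d)) * v"
        using elim by (intro mult_right_mono) (auto simp: p_def d_def v_def norm_minus_commute)
      finally have "2 * (F n x \<bullet> w n x - F (Suc n) x \<bullet> w n x) \<le> c * \<tau> * (2 * p * v) + 2 * (d * (c * v))"
        by (simp add: algebra_simps)
      also have "c * \<tau> * (2 * p * v) \<le> c * \<tau> * (p\<^sup>2 + v\<^sup>2)"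
        using c_nonneg \<tau>_pos sum_squares_bound[of p v] by (intro mult_left_mono) auto
      also have "2 * (d * (c * v)) \<le> (1 / \<tau>) * d\<^sup>2 + c\<^sup>2 * \<tau> * v\<^sup>2"
        using Young_norm[OF \<tau>_pos, of d "c * v"] by (simp add: power_mult_distrib algebra_simps)
      finally show ?case by (simp add: p_def d_def v_def power2_norm_eq_inner)
    qed
  qed (use le in \<open>auto intro!: integrable_fields Bochner_Integration.integrable_diff
      Bochner_Integration.integrable_add integrable_mult_right integrable_divide\<close>)
  also have "\<dots> = c * \<tau> * (B n + W n) + ((1 / \<tau>) * D n + c\<^sup>2 * \<tau> * W n)"
    unfolding B_def W_def D_def using le by (simp add: integrable_fields)
  finally show ?thesis by simp
qed

text \<open>Sum the dissipation steps, sum the source terms by parts, and bound every field that is left by the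
  energy estimate.\<close>

lemma dissipation_estimate:
  assumes k: "k \<in> {1..K}" and \<beta>2: "0 \<le> \<beta>2"
  shows "(1 / \<tau>) * (\<Sum>n=1..k. D n) + \<beta>1 / 2 * W k \<le> dissipation_const \<beta>1 \<beta>2 c T * (B 0 + W 0)"
proof -
  obtain j where j: "k = Suc j" "Suc j \<le> K" using k by (cases k) auto
  define S where "S = energy_const \<beta>1 \<beta>2 c T * (1 + T) * (B 0 + W 0)"
  have const_nonneg: "0 \<le> energy_const \<beta>1 \<beta>2 c T"
    using \<beta>2 by (simp add: energy_const_def)
  have "B 0 + \<tau> * W 0 \<le> (1 + T) * (B 0 + W 0)"
    using mult_right_mono[OF \<tau>_le_T nonneg(2)[of 0]] mult_nonneg_nonneg[OF less_imp_le[OF T_pos] nonneg(1)[of 0]] nonneg(2)[of 0]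
    by (simp add: algebra_simps)
  then have S: "B n + \<beta>1 * (\<tau> * (\<Sum>i=1..n. W i)) \<le> S" if "n \<le> K" for n
    using energy_estimate[OF that \<beta>2] mult_left_mono[OF _ const_nonneg]
    unfolding S_def mult.assoc by (meson order_trans)
  have sumW_nonneg: "0 \<le> \<tau> * (\<Sum>i=1..n. W i)" for n
    using \<tau>_pos nonneg by (intro mult_nonneg_nonneg sum_nonneg) auto
  have B_le: "B n \<le> S" if "n \<le> K" for n
    using S[OF that] mult_nonneg_nonneg[OF less_imp_le[OF \<beta>1_pos] sumW_nonneg[of n]] by linarith
  have W_le: "\<tau> * (\<Sum>i=1..j. W i) \<le> S / \<beta>1"
    using S[of j] nonneg(1)[of j] j \<beta>1_pos by (simp add: field_simps)
  have S_nonneg: "0 \<le> S" using B_le[of 0] nonneg(1)[of 0] by linarith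
  have "\<tau> * (\<Sum>n=1..j. B n) \<le> \<tau> * (\<Sum>n=1..j. S)"
    using \<tau>_pos B_le j by (intro mult_left_mono sum_mono) auto
  also have "\<dots> = (real j * \<tau>) * S" by simp
  also have "\<dots> \<le> (real K * \<tau>) * S"
    using j \<tau>_pos S_nonneg by (intro mult_right_mono) auto
  finally have sumB: "\<tau> * (\<Sum>n=1..j. B n) \<le> T * S" by (simp only: K_\<tau>)

  have "(\<Sum>n=1..k. (2 / \<tau>) * D n + P n - P (n - 1)) \<le> (\<Sum>n=1..k. 2 * (G n n - G n (n - 1)))"
    using k by (intro sum_mono dissipation_step) auto
  also have "\<dots> = 2 * (\<Sum>n=1..Suc j. G n n - G n (n - 1))"
    by (simp only: j sum_distrib_left)
  also have "\<dots> = 2 * G k k - 2 * G 1 0 + (\<Sum>n=1..j. 2 * (G n n - G (Suc n) n))"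
    by (subst summation_by_parts) (simp add: j sum_distrib_left right_diff_distrib)
  also have "\<dots> \<le> 2 * G k k - 2 * G 1 0
      + (\<Sum>n=1..j. c * \<tau> * (B n + W n) + (1 / \<tau>) * D n + c\<^sup>2 * \<tau> * W n)"
    using j by (intro add_left_mono sum_mono G_increment) auto
  also have "(\<Sum>n=1..j. c * \<tau> * (B n + W n) + (1 / \<tau>) * D n + c\<^sup>2 * \<tau> * W n)
      = c * (\<tau> * (\<Sum>n=1..j. B n)) + (c + c\<^sup>2) * (\<tau> * (\<Sum>n=1..j. W n)) + (1 / \<tau>) * (\<Sum>n=1..j. D n)"
    by (simp add: sum.distrib sum_distrib_left algebra_simps)
  also have "(\<Sum>n=1..k. (2 / \<tau>) * D n + P n - P (n - 1)) = (2 / \<tau>) * (\<Sum>n=1..k. D n) + P k - P 0"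
    by (induction k) (auto simp: algebra_simps)
  finally have main: "(2 / \<tau>) * (\<Sum>n=1..k. D n) + P k - P 0 \<le> 2 * G k k - 2 * G 1 0
      + (c * (\<tau> * (\<Sum>n=1..j. B n)) + (c + c\<^sup>2) * (\<tau> * (\<Sum>n=1..j. W n)) + (1 / \<tau>) * (\<Sum>n=1..j. D n))" .
  have "c * (\<tau> * (\<Sum>n=1..j. B n)) \<le> c * (T * S)"
    using sumB c_nonneg by (rule mult_left_mono)
  moreover have "(c + c\<^sup>2) * (\<tau> * (\<Sum>n=1..j. W n)) \<le> (c + c\<^sup>2) * (S / \<beta>1)"
    using W_le c_nonneg by (intro mult_left_mono) auto
  moreover have "(1 / \<tau>) * (\<Sum>n=1..j. D n) \<le> (1 / \<tau>) * (\<Sum>n=1..k. D n)"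
    using \<tau>_pos nonneg by (intro mult_left_mono) (auto simp: j)
  moreover have "2 * G k k \<le> 2 * c\<^sup>2 / \<beta>1 * S + \<beta>1 / 2 * W k"
  proof -
    have "2 * G k k \<le> 2 * \<bar>G k k\<bar>" by simp
    also have "\<dots> \<le> c\<^sup>2 / (\<beta>1 / 2) * B (k - 1) + \<beta>1 / 2 * W k"
      using k \<beta>1_pos by (intro G_bound) auto
    also have "c\<^sup>2 / (\<beta>1 / 2) * B (k - 1) \<le> c\<^sup>2 / (\<beta>1 / 2) * S"
      using k \<beta>1_pos by (intro mult_left_mono B_le) auto
    finally show ?thesis by (simp add: mult.commute)
  qed
  moreover have "- 2 * G 1 0 \<le> c\<^sup>2 * B 0 + W 0"
    using G_bound[of 1 0 1] K_pos by (simp add: abs_if split: if_splits)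
  moreover have "P 0 \<le> \<beta>2 * W 0" "\<beta>1 * W k \<le> P k"
    using weighted_upper(1)[of 0] P_lower[of k] k by auto
  moreover have "(2 / \<tau>) * (\<Sum>n=1..k. D n) = 2 * ((1 / \<tau>) * (\<Sum>n=1..k. D n))"
    "\<beta>1 * W k = 2 * (\<beta>1 / 2 * W k)" by simp_all
  ultimately have "(1 / \<tau>) * (\<Sum>n=1..k. D n) + \<beta>1 / 2 * W k
      \<le> \<beta>2 * W 0 + c\<^sup>2 * B 0 + W 0 + (2 * c\<^sup>2 / \<beta>1 * S + c * (T * S) + (c + c\<^sup>2) * (S / \<beta>1))"
    using main by linarith
  also have "\<dots> \<le> (1 + \<beta>2 + c\<^sup>2) * (B 0 + W 0) + (2 * c\<^sup>2 / \<beta>1 * S + c * (T * S) + (c + c\<^sup>2) * (S / \<beta>1))"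
    using mult_nonneg_nonneg[OF \<beta>2 nonneg(1)[of 0]] mult_nonneg_nonneg[OF zero_le_power2[of c] nonneg(2)[of 0]]
      nonneg(1)[of 0] by (simp add: algebra_simps)
  also have "\<dots> = dissipation_const \<beta>1 \<beta>2 c T * (B 0 + W 0)"
    unfolding dissipation_const_def S_def by (simp add: algebra_simps add_divide_distrib)
  finally show ?thesis .
qed

end

section \<open>Smooth test functions on the real line\<close>

lemma Ck_Suc_DERIV:
  fixes f f' :: "real \<Rightarrow> real"
  assumes "\<And>x. (f has_real_derivative f' x) (at x)"
  shows "Ck (Suc k) f \<longleftrightarrow> Ck k f'"
proof -
  have "(f has_derivative (\<lambda>h. f' x * h)) (at x)" for x
    using assms by (simp add: has_field_derivative_def)
  then have "frechet_derivative f (at x) = (\<lambda>h. f' x * h)" "f differentiable (at x)" for x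
    by (auto simp: frechet_derivative_at[symmetric] differentiable_def)
  then show ?thesis by (simp add: Basis_real_def)
qed

lemmas Ck_SucI = Ck_Suc_DERIV[THEN iffD2]

lemma Ck_Suc_imp: "Ck (Suc k) (f :: real \<Rightarrow> real) \<Longrightarrow> Ck k f"
proof (induction k arbitrary: f)
  case 0
  then show ?case by (auto intro!: continuous_at_imp_continuous_on differentiable_imp_continuous_within)
next
  case (Suc k)
  then show ?case by (metis Ck.simps(2))
qed

lemma Ck_DERIV_obtain:
  fixes f :: "real \<Rightarrow> real"
  assumes "Ck (Suc k) f"
  obtains f' where "\<And>x. (f has_real_derivative f' x) (at x)" "Ck k f'"
proof -
  have "f differentiable (at x)" for x using assms by simp
  then have "\<And>x. (f has_real_derivative (deriv f x)) (at x)"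
    by (metis DERIV_deriv_iff_real_differentiable)
  with assms show thesis using that Ck_Suc_DERIV by metis
qed

lemma Ck_add:
  fixes f g :: "real \<Rightarrow> real"
  assumes "Ck k f" "Ck k g"
  shows "Ck k (\<lambda>x. f x + g x)"
  using assms
proof (induction k arbitrary: f g)
  case (Suc k)
  obtain f' g' where d: "\<And>x. (f has_real_derivative f' x) (at x)" "\<And>x. (g has_real_derivative g' x) (at x)"
    and c: "Ck k f'" "Ck k g'"
    using Suc.prems by (metis Ck_DERIV_obtain)
  have "((\<lambda>x. f x + g x) has_real_derivative (f' x + g' x)) (at x)" for x
    using d by (auto intro!: derivative_intros)
  then show ?case by (rule Ck_SucI) (rule Suc.IH[OF c])
qed (auto intro: continuous_intros)

lemma Ck_mult:
  fixes f g :: "real \<Rightarrow> real"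
  assumes "Ck k f" "Ck k g"
  shows "Ck k (\<lambda>x. f x * g x)"
  using assms
proof (induction k arbitrary: f g)
  case (Suc k)
  obtain f' g' where d: "\<And>x. (f has_real_derivative f' x) (at x)" "\<And>x. (g has_real_derivative g' x) (at x)"
    and c: "Ck k f'" "Ck k g'"
    using Suc.prems by (metis Ck_DERIV_obtain)
  have "((\<lambda>x. f x * g x) has_real_derivative (f' x * g x + g' x * f x)) (at x)" for x
    using d by (rule DERIV_mult)
  moreover have "Ck k (\<lambda>x. f' x * g x + g' x * f x)"
    using Suc.prems c by (intro Ck_add Suc.IH Ck_Suc_imp[of k f] Ck_Suc_imp[of k g])
  ultimately show ?case by (rule Ck_SucI)
qed (auto intro: continuous_intros)

lemma Ck_affine:
  fixes f :: "real \<Rightarrow> real"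
  assumes "Ck k f"
  shows "Ck k (\<lambda>x. c * f (a * x + b))"
  using assms
proof (induction k arbitrary: f c)
  case 0
  then show ?case by (auto intro!: continuous_intros elim: continuous_on_compose2)
next
  case (Suc k)
  obtain f' where d: "\<And>x. (f has_real_derivative f' x) (at x)" and "Ck k f'"
    using Suc.prems by (metis Ck_DERIV_obtain)
  have "((\<lambda>x. c * f (a * x + b)) has_real_derivative ((c * a) * f' (a * x + b))) (at x)" for x
    by (auto intro!: derivative_eq_intros DERIV_chain2[OF d])
  then show ?case by (rule Ck_SucI) (rule Suc.IH[OF \<open>Ck k f'\<close>])
qed

text \<open>Functions that are flat at the origin. The class is closed under differentiation, which gives
  smoothness by a plain induction over the order of differentiability.\<close>

definition flat :: "real poly \<Rightarrow> real \<Rightarrow> real" where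
  "flat p x = (if 0 < x then poly p (1 / x) * exp (- (1 / x)) else 0)"

lemma poly_mult_exp_neg_tendsto_0:
  "((\<lambda>y. poly p y * exp (- y)) \<longlongrightarrow> (0::real)) at_top"
proof -
  have "((\<lambda>y. \<Sum>i\<le>degree p. coeff p i * (y ^ i / exp y)) \<longlongrightarrow> (\<Sum>i\<le>degree p. coeff p i * 0)) at_top"
    by (intro tendsto_intros tendsto_power_div_exp_0)
  then show ?thesis
    by (simp add: poly_altdef exp_minus sum_distrib_right divide_inverse mult.assoc)
qed

lemma flat_tendsto_0: "(flat p \<longlongrightarrow> 0) (at 0)"
proof -
  have "((\<lambda>x. poly p (inverse x) * exp (- inverse x)) \<longlongrightarrow> 0) (at_right (0::real))"
    by (rule filterlim_compose[OF poly_mult_exp_neg_tendsto_0 filterlim_inverse_at_top_right])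
  then have "(flat p \<longlongrightarrow> 0) (at_right 0)"
    by (rule Lim_transform_eventually)
      (auto simp: flat_def eventually_at_filter divide_inverse)
  moreover have "(flat p \<longlongrightarrow> 0) (at_left 0)"
    by (rule Lim_transform_eventually[OF tendsto_const])
      (auto simp: flat_def eventually_at_filter)
  ultimately show ?thesis by (simp add: filterlim_split_at)
qed

lemma flat_DERIV: "(flat p has_real_derivative flat ((p - pderiv p) * [:0, 0, 1:]) x) (at x)"
proof -
  consider "0 < x" | "x = 0" | "x < 0" by linarith
  then show ?thesis
  proof cases
    case 1
    have "((\<lambda>x. poly p (1 / x) * exp (- (1 / x))) has_real_derivative flat ((p - pderiv p) * [:0, 0, 1:]) x) (at x)"
      using 1
      by (auto intro!: derivative_eq_intros DERIV_chain2[OF poly_DERIV]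
          simp: flat_def field_simps power2_eq_square)
    then show ?thesis
      by (rule DERIV_cong_ev[OF refl _ refl, THEN iffD1, rotated])
        (use 1 eventually_nhds_in_open[of "{0<..}" x] in \<open>auto simp: flat_def elim: eventually_mono\<close>)
  next
    case 2
    \<comment> \<open>The difference quotient at the origin is itself of the form flat, for the polynomial X p.\<close>
    have "((\<lambda>h. flat ([:0, 1:] * p) h) \<longlongrightarrow> 0) (at 0)" by (rule flat_tendsto_0)
    then have "((\<lambda>h. (flat p (0 + h) - flat p 0) / h) \<longlongrightarrow> 0) (at 0)"
      by (rule Lim_transform_eventually)
        (auto simp: flat_def eventually_at_filter)
    then show ?thesis using 2 by (simp add: DERIV_def flat_def)
  next
    case 3
    have "((\<lambda>x. 0) has_real_derivative flat ((p - pderiv p) * [:0, 0, 1:]) x) (at x)"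
      using 3 by (simp add: flat_def)
    then show ?thesis
      by (rule DERIV_cong_ev[OF refl _ refl, THEN iffD1, rotated])
        (use 3 eventually_nhds_in_open[of "{..<0}" x] in \<open>auto simp: flat_def elim: eventually_mono\<close>)
  qed
qed

lemma Ck_flat: "Ck k (flat p)"
proof (induction k arbitrary: p)
  case 0
  then show ?case
    using flat_DERIV by (auto intro!: continuous_at_imp_continuous_on DERIV_isCont)
next
  case (Suc k)
  then show ?case by (intro Ck_SucI[OF flat_DERIV])
qed

text \<open>The shift by one in both factors makes the support a compact subset of the open interval \<open>(a, b)\<close>,
  so that test functions can be built from bumps even when \<open>a\<close> and \<open>b\<close> are end points of the time
  interval. The bumps converge to the indicator function as \<open>j\<close> tends to infinity.\<close>

definition bump :: "real \<Rightarrow> real \<Rightarrow> nat \<Rightarrow> real \<Rightarrow> real" where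
  "bump a b j t = flat 1 (real j * (t - a) - 1) * flat 1 (real j * (b - t) - 1)"

lemma Ck_bump: "Ck k (bump a b j)"
proof -
  have "Ck k (\<lambda>t. (1 * flat 1 (real j * t + (- real j * a - 1))) * (1 * flat 1 ((- real j) * t + (real j * b - 1))))"
    by (intro Ck_mult Ck_affine Ck_flat)
  also have "(\<lambda>t. (1 * flat 1 (real j * t + (- real j * a - 1))) * (1 * flat 1 ((- real j) * t + (real j * b - 1)))) = bump a b j"
    by (auto simp: bump_def algebra_simps)
  finally show ?thesis .
qed

lemma bump_bounds: "0 \<le> bump a b j t" "bump a b j t \<le> 1"
proof -
  have "0 \<le> flat 1 x" "flat 1 x \<le> 1" for x by (auto simp: flat_def)
  then show "0 \<le> bump a b j t" "bump a b j t \<le> 1"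
    unfolding bump_def by (auto intro!: mult_le_one)
qed

lemma bump_support: "0 < j \<Longrightarrow> t \<notin> {a + 1 / real j<..<b - 1 / real j} \<Longrightarrow> bump a b j t = 0"
  by (auto simp: bump_def flat_def field_simps)

lemma bump_tendsto: "(\<lambda>j. bump a b j t) \<longlonglongrightarrow> indicator {a<..<b} t"
proof (cases "t \<in> {a<..<b}")
  case True
  have lim: "(\<lambda>j. flat 1 (real j * d - 1)) \<longlonglongrightarrow> 1" if "0 < d" for d
  proof -
    have *: "filterlim (\<lambda>j. real j * d - 1) at_top sequentially"
      using filterlim_tendsto_add_at_top[OF tendsto_const[of "- 1"]
          filterlim_at_top_mult_tendsto_pos[OF tendsto_const that filterlim_real_sequentially]]
      by simp
    have "((\<lambda>x::real. exp (- inverse x)) \<longlongrightarrow> exp (- 0)) at_top"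
      by (intro tendsto_intros tendsto_inverse_0_at_top filterlim_ident)
    then have "((\<lambda>x::real. exp (- (1 / x))) \<longlongrightarrow> 1) at_top" by (simp add: inverse_eq_divide)
    moreover have "eventually (\<lambda>x::real. exp (- (1 / x)) = flat 1 x) at_top"
      using eventually_gt_at_top[of 0] by eventually_elim (simp add: flat_def)
    ultimately have "(flat 1 \<longlongrightarrow> 1) at_top" by (rule Lim_transform_eventually)
    then show ?thesis using * by (rule filterlim_compose)
  qed
  have "(\<lambda>j. bump a b j t) \<longlonglongrightarrow> 1 * 1"
    unfolding bump_def using True by (intro tendsto_mult lim) auto
  then show ?thesis using True by simp
next
  case False
  have "bump a b j t = 0" for j
  proof (cases "j = 0")
    case False
    then have "0 < 1 / real j" by simp
    then have "t \<notin> {a + 1 / real j<..<b - 1 / real j}"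
      using \<open>t \<notin> {a<..<b}\<close> unfolding greaterThanLessThan_iff by linarith
    then show ?thesis using False bump_support by blast
  qed (simp add: bump_def flat_def)
  then show ?thesis using False by simp
qed

text \<open>Take \<open>\<phi> t = \<Phi> (t - \<tau>) - \<Phi> t\<close> for a primitive \<open>\<Phi>\<close> of the bump. By the mean value theorem \<open>\<phi> t\<close> is
  \<open>-\<tau>\<close> times a value of the bump between \<open>t - \<tau>\<close> and \<open>t\<close>, which gives the bound and the support at
  the same time.\<close>

lemma shifted_bump_test_function:
  fixes a b T \<tau> :: real
  assumes j: "0 < j" and \<tau>: "0 < \<tau>" and "0 \<le> a" "b + \<tau> \<le> T"
  obtains \<phi> where "test_function {0<..<T} \<phi>"
    "\<And>t. (\<phi> has_real_derivative (bump a b j (t - \<tau>) - bump a b j t)) (at t)"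
    "\<And>t. \<bar>\<phi> t\<bar> \<le> \<tau>" "\<And>t. t \<notin> {a..b + \<tau>} \<Longrightarrow> \<phi> t = 0"
proof -
  have "continuous_on UNIV (bump a b j)" using Ck_bump[of 0 a b j] by simp
  then have "\<And>x. isCont (bump a b j) x" using continuous_on_eq_continuous_at by blast
  then have "\<exists>\<Phi>. \<forall>x::real. - \<infinity> < ereal x \<longrightarrow> ereal x < \<infinity> \<longrightarrow> (\<Phi> has_vector_derivative bump a b j x) (at x)"
    by (intro einterval_antiderivative) auto
  then obtain \<Phi> where \<Phi>: "\<And>x. (\<Phi> has_real_derivative bump a b j x) (at x)"
    by (auto simp: has_real_derivative_iff_has_vector_derivative)
  define \<phi> where "\<phi> t = \<Phi> (t - \<tau>) - \<Phi> t" for t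
  have d: "(\<phi> has_real_derivative (bump a b j (t - \<tau>) - bump a b j t)) (at t)" for t
    unfolding \<phi>_def by (auto intro!: derivative_eq_intros DERIV_chain2[OF \<Phi>] \<Phi>)
  have mvt: "\<exists>\<xi>. t - \<tau> < \<xi> \<and> \<xi> < t \<and> \<phi> t = - \<tau> * bump a b j \<xi>" for t
    using MVT2[of "t - \<tau>" t \<Phi> "bump a b j"] \<Phi> \<tau> by (auto simp: \<phi>_def algebra_simps)
  have bound: "\<bar>\<phi> t\<bar> \<le> \<tau>" for t
  proof -
    obtain \<xi> where "\<phi> t = - \<tau> * bump a b j \<xi>" using mvt by blast
    then show ?thesis using \<tau> bump_bounds[of a b j \<xi>] by (simp add: abs_mult)
  qed
  have supp: "\<phi> t = 0" if t: "t \<notin> {a + 1 / real j..b + \<tau> - 1 / real j}" for t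
  proof -
    obtain \<xi> where \<xi>: "t - \<tau> < \<xi>" "\<xi> < t" "\<phi> t = - \<tau> * bump a b j \<xi>" using mvt by blast
    then have "\<xi> \<notin> {a + 1 / real j<..<b - 1 / real j}" using t by auto
    then show ?thesis using \<xi>(3) bump_support[OF j] by simp
  qed
  have "{t. \<phi> t \<noteq> 0} \<subseteq> {a + 1 / real j..b + \<tau> - 1 / real j}" using supp by blast
  then have cl: "closure {t. \<phi> t \<noteq> 0} \<subseteq> {a + 1 / real j..b + \<tau> - 1 / real j}"
    by (rule closure_minimal) simp
  have jpos: "0 < 1 / real j" using j by simp
  show thesis
  proof
    have "Ck (Suc k) \<phi>" for k
    proof -
      have "Ck k (\<lambda>t. 1 * bump a b j (1 * t + (- \<tau>)) + (- 1) * bump a b j (1 * t + 0))"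
        by (intro Ck_add Ck_affine Ck_bump)
      then show ?thesis using Ck_Suc_DERIV[OF d] by simp
    qed
    then have "Ck k \<phi>" for k using Ck_Suc_imp by blast
    moreover have "compact (closure {t. \<phi> t \<noteq> 0})"
      using cl by (meson compact_Icc compact_closure bounded_subset compact_imp_bounded closure_subset order_trans)
    moreover have "{a + 1 / real j..b + \<tau> - 1 / real j} \<subseteq> {0<..<T}"
      using assms jpos unfolding subset_iff atLeastAtMost_iff greaterThanLessThan_iff by linarith
    ultimately show "test_function {0<..<T} \<phi>"
      unfolding test_function_def using cl by blast
    show "\<phi> t = 0" if "t \<notin> {a..b + \<tau>}" for t
      using that jpos by (intro supp) (unfold atLeastAtMost_iff, linarith)
  qed (rule d bound)+
qed

section \<open>Time averages of Lipschitz functions with values in \<open>L\<^sup>\<infinity>\<close>\<close>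

lemma AE_lebesgue_on_iff:
  "S \<in> sets lebesgue \<Longrightarrow> (AE x in lebesgue_on S. P x) \<longleftrightarrow> (AE x in lborel. x \<in> S \<longrightarrow> P x)"
  by (subst AE_restrict_space_iff) (auto simp: AE_completion_iff)

text \<open>The exceptional set need not be Borel, so it is first enlarged to a Borel null set, to which Fubini's
  theorem applies in both orders.\<close>

lemma AE_lborel_sections:
  assumes "AE p in (lborel :: ('a::euclidean_space \<times> 'b::euclidean_space) measure). R p"
  shows "AE x in lborel. AE y in lborel. R (x, y)" "AE y in lborel. AE x in lborel. R (x, y)"
proof -
  obtain N where N: "{p \<in> space lborel. \<not> R p} \<subseteq> N" "N \<in> null_sets (lborel :: ('a \<times> 'b) measure)"
    using AE_E3[OF assms] by (metis (lifting) Diff_iff mem_Collect_eq subsetI)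
  then have sets: "N \<in> sets (lborel \<Otimes>\<^sub>M lborel :: ('a \<times> 'b) measure)"
    using null_setsD2[OF N(2)] unfolding lborel_prod by blast
  have "AE p in lborel \<Otimes>\<^sub>M lborel. p \<notin> N"
    using AE_not_in[OF N(2)] by (subst lborel_prod)
  then have *: "AE x in lborel. AE y in lborel. (x, y) \<notin> N" by (rule lborel_pair.AE_pair)
  then show "AE x in lborel. AE y in lborel. R (x, y)"
    using N(1) by (elim eventually_mono) auto
  have "AE y in lborel. AE x in lborel. (x, y) \<notin> N"
    using * sets.compl_sets[OF sets]
    by (subst lborel_pair.AE_commute[symmetric]) (simp_all add: set_diff_eq)
  then show "AE y in lborel. AE x in lborel. R (x, y)"
    using N(1) by (elim eventually_mono) auto
qed

lemma lebesgue_measurable_borel_version: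
  fixes h :: "'a::euclidean_space \<Rightarrow> 'b::euclidean_space"
  assumes "h \<in> borel_measurable lebesgue"
  obtains g where "g \<in> borel_measurable borel" "AE x in lborel. h x = g x"
proof -
  have "\<exists>g. g \<in> borel_measurable lborel \<and> (AE x in lborel. h x \<bullet> e = g x)" for e
    using completion_ex_borel_measurable_real[of "\<lambda>x. h x \<bullet> e" lborel] assms by auto
  then obtain g where g: "\<And>e. g e \<in> borel_measurable lborel" "\<And>e. AE x in lborel. h x \<bullet> e = g e x"
    by metis
  have [measurable]: "g e \<in> borel_measurable borel" for e using g(1)[of e] by simp
  show thesis
  proof
    show "(\<lambda>x. \<Sum>e\<in>Basis. g e x *\<^sub>R e) \<in> borel_measurable borel" by measurable
    have "AE x in lborel. \<forall>e\<in>Basis. h x \<bullet> e = g e x"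
      using g(2) by (intro AE_finite_allI) auto
    then show "AE x in lborel. h x = (\<Sum>e\<in>Basis. g e x *\<^sub>R e)"
    proof eventually_elim
      case (elim x)
      then have "(\<Sum>e\<in>Basis. g e x *\<^sub>R e) = (\<Sum>e\<in>Basis. (h x \<bullet> e) *\<^sub>R e)" by simp
      then show ?case by (simp add: euclidean_representation)
    qed
  qed
qed

lemma integral_lebesgue_borel_version:
  fixes f g :: "'a::euclidean_space \<Rightarrow> 'b::euclidean_space"
  assumes g: "g \<in> borel_measurable borel" and eq: "AE x in lborel. f x = g x"
  shows "(LINT x|lebesgue. f x) = (LINT x|lborel. g x)"
proof -
  have g': "g \<in> borel_measurable lebesgue" using g by (simp add: measurable_completion)
  have ae: "AE x in lebesgue. g x = f x" using eq by (intro AE_completion) (auto elim: eventually_mono)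
  have "(LINT x|lebesgue. f x) = (LINT x|lebesgue. g x)"
    using ae by (intro integral_cong_AE borel_measurable_AE[OF g' ae] g') (auto elim: eventually_mono)
  then show ?thesis using g by (simp add: integral_completion)
qed

text \<open>A representative that is Borel, and bounded everywhere, makes all later integrals over time
  unproblematic. The bound in \<open>L\<^sup>\<infinity>\<close> holds for almost every \<open>t\<close> at almost every \<open>x\<close>; for the Borel
  representative the two quantifiers can be exchanged, and the values that violate the bound are
  replaced by zero.\<close>

lemma Linf_Linf_bounded_borel_version:
  fixes F :: "real \<Rightarrow> 'a::euclidean_space \<Rightarrow> 'b::euclidean_space"
  assumes F: "F \<in> Linf_Linf T S" and S: "S \<in> sets borel"
  obtains g c where "g \<in> borel_measurable borel" "0 \<le> c" "\<And>p. norm (g p) \<le> c"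
    "AE x in lborel. x \<in> S \<longrightarrow> (AE t in lborel. t \<in> {0<..<T} \<longrightarrow> F t x = g (t, x))"
proof -
  have S': "S \<in> sets lebesgue" using S by simp
  have IS: "{0<..<T} \<times> S \<in> sets lebesgue"
  proof -
    have "{0<..<T} \<times> S \<in> sets (borel :: (real \<times> 'a) measure)"
      unfolding borel_prod[symmetric] using S by (intro pair_measureI) auto
    then show ?thesis by simp
  qed
  define h where "h p = (if p \<in> {0<..<T} \<times> S then F (fst p) (snd p) else 0)" for p
  have "h \<in> borel_measurable lebesgue"
    unfolding h_def using F IS by (subst borel_measurable_if) (auto simp: Linf_Linf_def)
  then obtain g where [measurable]: "g \<in> borel_measurable borel" and "AE p in lborel. h p = g p"
    by (rule lebesgue_measurable_borel_version)
  note sections = AE_lborel_sections[OF this(2)]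
  obtain c where "AE t in lebesgue_on {0<..<T}. Linf_norm S (F t) \<le> ereal c"
    using F by (auto simp: Linf_Linf_def)
  then have "AE t in lborel. t \<in> {0<..<T} \<longrightarrow> Linf_norm S (F t) \<le> ereal c"
    by (subst (asm) AE_lebesgue_on_iff) auto
  with sections(1) have "AE t in lborel. AE x in lborel. t \<in> {0<..<T} \<and> x \<in> S \<longrightarrow> norm (g (t, x)) \<le> c"
  proof eventually_elim
    case (elim t)
    have "AE x in lborel. x \<in> S \<longrightarrow> ereal (norm (F t x)) \<le> Linf_norm S (F t)"
      unfolding Linf_norm_def using esssup_AE[of "\<lambda>x. ereal (norm (F t x))" "lebesgue_on S"]
      by (subst (asm) AE_lebesgue_on_iff[OF S'])
    with elim(1) show ?case
    proof eventually_elim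
      case (elim x)
      have "ereal (norm (g (t, x))) \<le> ereal c" if "t \<in> {0<..<T}" "x \<in> S"
      proof -
        have "ereal (norm (g (t, x))) \<le> Linf_norm S (F t)"
          using elim that by (auto simp: h_def)
        also have "\<dots> \<le> ereal c"
          using \<open>t \<in> {0<..<T} \<longrightarrow> Linf_norm S (F t) \<le> ereal c\<close> that by blast
        finally show ?thesis .
      qed
      then show ?case by simp
    qed
  qed
  then have "AE x in lborel. AE t in lborel. t \<in> {0<..<T} \<and> x \<in> S \<longrightarrow> norm (g (t, x)) \<le> c"
  proof (subst lborel_pair.AE_commute[symmetric], goal_cases)
    case 1
    have [measurable]: "g \<in> borel_measurable (borel \<Otimes>\<^sub>M borel)" by (simp add: borel_prod)
    have "{p \<in> space (borel \<Otimes>\<^sub>M borel). fst p \<in> {0<..<T} \<and> snd p \<in> S \<longrightarrow> norm (g p) \<le> c} \<in> sets (borel \<Otimes>\<^sub>M borel)"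
      using S by measurable
    then show ?case by (simp add: space_pair_measure)
  qed
  then have bound: "AE x in lborel. x \<in> S \<longrightarrow> (AE t in lborel. t \<in> {0<..<T} \<longrightarrow> norm (g (t, x)) \<le> c)"
    by eventually_elim auto
  show thesis
  proof
    show "(\<lambda>p. if norm (g p) \<le> max 0 c then g p else 0) \<in> borel_measurable borel" by measurable
    show "norm (if norm (g p) \<le> max 0 c then g p else 0) \<le> max 0 c" for p by auto
    show "AE x in lborel. x \<in> S \<longrightarrow> (AE t in lborel. t \<in> {0<..<T} \<longrightarrow>
        F t x = (if norm (g (t, x)) \<le> max 0 c then g (t, x) else 0))"
      using bound sections(2)
    proof eventually_elim
      case (elim x)
      show ?case
      proof
        assume "x \<in> S"
        then have "AE t in lborel. t \<in> {0<..<T} \<longrightarrow> norm (g (t, x)) \<le> c" using elim by simp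
        with elim(2) show "AE t in lborel. t \<in> {0<..<T} \<longrightarrow>
            F t x = (if norm (g (t, x)) \<le> max 0 c then g (t, x) else 0)"
          by eventually_elim (auto simp: h_def \<open>x \<in> S\<close>)
      qed
    qed
  qed simp
qed

lemma integral_section_borel_version:
  fixes F :: "real \<Rightarrow> 'a::euclidean_space \<Rightarrow> 'b::euclidean_space" and \<psi> :: "real \<Rightarrow> real"
  assumes [measurable]: "g \<in> borel_measurable borel" "\<psi> \<in> borel_measurable borel" "J \<in> sets borel"
    and J: "J \<subseteq> {0..T}"
    and eq: "AE t in lborel. t \<in> {0<..<T} \<longrightarrow> F t x = g (t, x)"
  shows "(LINT t|lebesgue_on J. \<psi> t *\<^sub>R F t x) = (LINT t|lborel. indicator J t *\<^sub>R (\<psi> t *\<^sub>R g (t, x)))"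
proof -
  have "(LINT t|lebesgue_on J. \<psi> t *\<^sub>R F t x) = (LINT t|lebesgue. indicator J t *\<^sub>R (\<psi> t *\<^sub>R F t x))"
    by (rule integral_restrict_space) simp
  also have "\<dots> = (LINT t|lborel. indicator J t *\<^sub>R (\<psi> t *\<^sub>R g (t, x)))"
  proof (rule integral_lebesgue_borel_version)
    show "(\<lambda>t. indicator J t *\<^sub>R (\<psi> t *\<^sub>R g (t, x))) \<in> borel_measurable borel"
      by measurable
    show "AE t in lborel. indicator J t *\<^sub>R (\<psi> t *\<^sub>R F t x) = indicator J t *\<^sub>R (\<psi> t *\<^sub>R g (t, x))"
      using eq AE_lborel_singleton[of 0] AE_lborel_singleton[of T]
      by eventually_elim (use J in \<open>auto simp: indicator_def\<close>)
  qed
  finally show ?thesis .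
qed

lemma integrable_indicator_Icc:
  fixes l r :: real
  shows "integrable lborel (indicat_real {l..r})"
  by (intro integrable_real_indicator) (auto simp: emeasure_lborel_Icc_eq)

lemma integrable_bounded_on_interval:
  fixes f :: "real \<Rightarrow> 'b::euclidean_space"
  assumes [measurable]: "f \<in> borel_measurable borel" and "\<And>t. norm (f t) \<le> c"
    and [measurable]: "J \<in> sets borel" and "J \<subseteq> {l..r}"
  shows "integrable lborel (\<lambda>t. indicator J t *\<^sub>R f t)"
proof (rule Bochner_Integration.integrable_bound)
  show "integrable lborel (\<lambda>t. indicator {l..r} t * c)"
    by (intro integrable_mult_left integrable_indicator_Icc)
  show "AE t in lborel. norm (indicator J t *\<^sub>R f t) \<le> norm (indicator {l..r} t * c)"
  proof (rule AE_I2)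
    fix t
    have "norm (f t) \<le> \<bar>c\<bar>" using assms(2)[of t] by linarith
    then show "norm (indicator J t *\<^sub>R f t) \<le> norm (indicator {l..r} t * c)"
      using assms(4) by (auto simp: indicator_def)
  qed
qed measurable

lemma norm_integral_bounded_on_interval:
  fixes f :: "real \<Rightarrow> 'b::euclidean_space"
  assumes "l \<le> r" "0 \<le> c" and "\<And>t. t \<in> {l..r} \<Longrightarrow> norm (f t) \<le> c" "\<And>t. t \<notin> {l..r} \<Longrightarrow> f t = 0"
  shows "norm (LINT t|lborel. f t) \<le> (r - l) * c"
proof -
  have "norm (LINT t|lborel. f t) \<le> (LINT t|lborel. indicator {l..r} t * c)"
  proof (cases "integrable lborel f")
    case True
    then show ?thesis
      using assms by (intro order_trans[OF integral_norm_bound] integral_mono integrable_norm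
          integrable_mult_left integrable_indicator_Icc) (auto simp: indicator_def)
  next
    case False
    then show ?thesis using assms by (simp add: not_integrable_integral_eq)
  qed
  also have "\<dots> = (r - l) * c" using assms by simp
  finally show ?thesis .
qed

text \<open>Two consecutive integrals of \<open>F\<close> differ by the integral of \<open>F\<close> against the difference of two indicator
  functions. This difference is the limit of derivatives of test functions \<open>\<phi>\<close> with \<open>|\<phi>| \<le> \<tau>\<close> and a support
  of length \<open>2 \<tau>\<close>, and the weak derivative turns each such integral into one of at most \<open>2 \<tau>\<^sup>2 d\<close>. Countably
  many test functions suffice, so a single null set of points \<open>x\<close> is discarded.\<close>

lemma W1inf_increment_bound:
  fixes F :: "real \<Rightarrow> 'a::euclidean_space \<Rightarrow> 'b::euclidean_space"
  assumes gm: "g \<in> borel_measurable borel" and gc: "\<And>p. norm (g p) \<le> c"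
    and g: "AE x in lborel. x \<in> S \<longrightarrow> (AE t in lborel. t \<in> {0<..<T} \<longrightarrow> F t x = g (t, x))"
    and hm: "h \<in> borel_measurable borel" and hd: "\<And>p. norm (h p) \<le> d"
    and h: "AE x in lborel. x \<in> S \<longrightarrow> (AE t in lborel. t \<in> {0<..<T} \<longrightarrow> G t x = h (t, x))"
    and deriv: "\<And>\<phi>::real \<Rightarrow> real. test_function {0<..<T} \<phi> \<Longrightarrow>
        AE x in lborel. x \<in> S \<longrightarrow> (LINT t|lebesgue_on {0<..<T}. deriv \<phi> t *\<^sub>R F t x)
             = - (LINT t|lebesgue_on {0<..<T}. \<phi> t *\<^sub>R G t x)"
    and a: "0 \<le> a" "a + 2 * \<tau> \<le> T" "0 < \<tau>"
  shows "AE x in lborel. x \<in> S \<longrightarrow>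
    norm ((LINT t|lborel. indicator {a + \<tau>..a + 2 * \<tau>} t *\<^sub>R g (t, x))
        - (LINT t|lborel. indicator {a..a + \<tau>} t *\<^sub>R g (t, x))) \<le> 2 * \<tau>\<^sup>2 * d"
proof -
  note [measurable] = gm hm
  define B where "B j = bump a (a + \<tau>) (Suc j)" for j
  have [measurable]: "B j \<in> borel_measurable borel" for j
    using Ck_bump[of 0 a "a + \<tau>" "Suc j"] unfolding B_def
    by (intro borel_measurable_continuous_onI) simp
  have "\<exists>\<phi>. test_function {0<..<T} \<phi> \<and>
      (\<forall>t. (\<phi> has_real_derivative (B j (t - \<tau>) - B j t)) (at t)) \<and>
      (\<forall>t. \<bar>\<phi> t\<bar> \<le> \<tau>) \<and> (\<forall>t. t \<notin> {a..a + 2 * \<tau>} \<longrightarrow> \<phi> t = 0)" for j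
    unfolding B_def
    by (rule shifted_bump_test_function[of "Suc j" \<tau> a "a + \<tau>" T]) (use a in \<open>auto simp: algebra_simps\<close>)
  then obtain \<phi> where test: "\<And>j. test_function {0<..<T} (\<phi> j)"
    and \<phi>_deriv: "\<And>j t. (\<phi> j has_real_derivative (B j (t - \<tau>) - B j t)) (at t)"
    and \<phi>_bound: "\<And>j t. \<bar>\<phi> j t\<bar> \<le> \<tau>" and \<phi>_supp: "\<And>j t. t \<notin> {a..a + 2 * \<tau>} \<Longrightarrow> \<phi> j t = 0"
    by metis
  have [measurable]: "\<phi> j \<in> borel_measurable borel" for j
    using \<phi>_deriv by (intro borel_measurable_continuous_onI continuous_at_imp_continuous_on)
      (auto intro: DERIV_isCont)
  have deriv_\<phi>: "deriv (\<phi> j) = (\<lambda>t. B j (t - \<tau>) - B j t)" for j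
    using \<phi>_deriv by (auto intro: DERIV_imp_deriv)
  have "AE x in lborel. \<forall>j. x \<in> S \<longrightarrow> (LINT t|lebesgue_on {0<..<T}. deriv (\<phi> j) t *\<^sub>R F t x)
             = - (LINT t|lebesgue_on {0<..<T}. \<phi> j t *\<^sub>R G t x)"
    using deriv[OF test] unfolding AE_all_countable by blast
  with g h show ?thesis
  proof eventually_elim
    case (elim x)
    show ?case
    proof
      assume x: "x \<in> S"
      note Fg = elim(1)[rule_format, OF x] and Gh = elim(2)[rule_format, OF x]
      let ?I = "\<lambda>j. LINT t|lborel. indicator {0<..<T} t *\<^sub>R ((B j (t - \<tau>) - B j t) *\<^sub>R g (t, x))"
      let ?L = "LINT t|lborel. indicator {0<..<T} t *\<^sub>R ((indicator {a<..<a + \<tau>} (t - \<tau>) - indicator {a<..<a + \<tau>} t) *\<^sub>R g (t, x))"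
      have bound: "norm (?I j) \<le> 2 * \<tau>\<^sup>2 * d" for j
      proof -
        have "?I j = (LINT t|lebesgue_on {0<..<T}. deriv (\<phi> j) t *\<^sub>R F t x)"
          unfolding deriv_\<phi>
          by (rule integral_section_borel_version[where g = g and x = x and T = T, symmetric])
            (use Fg in auto)
        also have "\<dots> = - (LINT t|lebesgue_on {0<..<T}. \<phi> j t *\<^sub>R G t x)"
          using elim(3) x by blast
        also have "(LINT t|lebesgue_on {0<..<T}. \<phi> j t *\<^sub>R G t x)
            = (LINT t|lborel. indicator {0<..<T} t *\<^sub>R (\<phi> j t *\<^sub>R h (t, x)))"
          by (rule integral_section_borel_version[where g = h and x = x and T = T])
            (use Gh in auto)
        also have "norm (- \<dots>) \<le> (a + 2 * \<tau> - a) * (\<tau> * d)"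
          unfolding norm_minus_cancel
        proof (rule norm_integral_bounded_on_interval)
          have d: "0 \<le> d" using hd[of undefined] norm_ge_zero order_trans by blast
          then show "0 \<le> \<tau> * d" "a \<le> a + 2 * \<tau>" using a by auto
          have "\<bar>\<phi> j t\<bar> * norm (h (t, x)) \<le> \<tau> * d" for t
            using \<phi>_bound hd d a by (intro mult_mono) auto
          then show "norm (indicator {0<..<T} t *\<^sub>R (\<phi> j t *\<^sub>R h (t, x))) \<le> \<tau> * d" for t
            using \<open>0 \<le> \<tau> * d\<close> by (auto simp: indicator_def)
        qed (use \<phi>_supp in auto)
        finally show ?thesis by (simp add: power2_eq_square)
      qed
      have "?I \<longlonglongrightarrow> ?L"
      proof (rule integral_dominated_convergence)
        show "integrable lborel (\<lambda>t. indicator {0..T} t * (2 * c))"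
          by (intro integrable_mult_left integrable_indicator_Icc)
        show "AE t in lborel. (\<lambda>j. indicator {0<..<T} t *\<^sub>R ((B j (t - \<tau>) - B j t) *\<^sub>R g (t, x)))
            \<longlonglongrightarrow> indicator {0<..<T} t *\<^sub>R ((indicator {a<..<a + \<tau>} (t - \<tau>) - indicator {a<..<a + \<tau>} t) *\<^sub>R g (t, x))"
          unfolding B_def by (intro AE_I2 tendsto_intros LIMSEQ_Suc bump_tendsto)
        fix j
        show "AE t in lborel. norm (indicator {0<..<T} t *\<^sub>R ((B j (t - \<tau>) - B j t) *\<^sub>R g (t, x)))
            \<le> indicator {0..T} t * (2 * c)"
        proof (rule AE_I2)
          fix t
          have "\<bar>B j (t - \<tau>) - B j t\<bar> \<le> 2"
            unfolding B_def using bump_bounds[of a "a + \<tau>" "Suc j" t] bump_bounds[of a "a + \<tau>" "Suc j" "t - \<tau>"]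
            by linarith
          then have "\<bar>B j (t - \<tau>) - B j t\<bar> * norm (g (t, x)) \<le> 2 * c"
            using gc by (intro mult_mono) auto
          then show "norm (indicator {0<..<T} t *\<^sub>R ((B j (t - \<tau>) - B j t) *\<^sub>R g (t, x)))
            \<le> indicator {0..T} t * (2 * c)"
            using order_trans[OF norm_ge_zero gc] by (auto simp: indicator_def)
        qed
      qed measurable
      then have "norm ?L \<le> 2 * \<tau>\<^sup>2 * d"
        using bound by (intro LIMSEQ_le_const2[OF tendsto_norm]) auto
      also have "?L = (LINT t|lborel. indicator {a + \<tau>..a + 2 * \<tau>} t *\<^sub>R g (t, x)
          - indicator {a..a + \<tau>} t *\<^sub>R g (t, x))"
      proof (rule integral_cong_AE)
        show "AE t in lborel. indicator {0<..<T} t *\<^sub>R ((indicator {a<..<a + \<tau>} (t - \<tau>) - indicator {a<..<a + \<tau>} t) *\<^sub>R g (t, x))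
          = indicator {a + \<tau>..a + 2 * \<tau>} t *\<^sub>R g (t, x) - indicator {a..a + \<tau>} t *\<^sub>R g (t, x)"
          using AE_lborel_singleton[of a] AE_lborel_singleton[of "a + \<tau>"] AE_lborel_singleton[of "a + 2 * \<tau>"]
          by eventually_elim (use a in \<open>auto simp: indicator_def\<close>)
      qed measurable
      also have "\<dots> = (LINT t|lborel. indicator {a + \<tau>..a + 2 * \<tau>} t *\<^sub>R g (t, x))
          - (LINT t|lborel. indicator {a..a + \<tau>} t *\<^sub>R g (t, x))"
        by (intro Bochner_Integration.integral_diff integrable_bounded_on_interval[OF _ gc]) auto
      finally show "norm ((LINT t|lborel. indicator {a + \<tau>..a + 2 * \<tau>} t *\<^sub>R g (t, x))
        - (LINT t|lborel. indicator {a..a + \<tau>} t *\<^sub>R g (t, x))) \<le> 2 * \<tau>\<^sup>2 * d" .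
    qed
  qed
qed

text \<open>The discrete counterpart of \<open>W\<^sup>1\<^sup>,\<^sup>\<infinity>\<close> regularity: the time averages are bounded and Lipschitz in the
  step number, with one constant for all step sizes.\<close>

lemma time_average_bounds:
  fixes F :: "real \<Rightarrow> 'a::euclidean_space \<Rightarrow> 'b::euclidean_space"
  assumes F: "F \<in> W1inf_Linf T S" and S: "S \<in> sets borel" and T: "0 < T"
  obtains c where "0 \<le> c"
    "\<And>K n. n \<in> {1..K} \<Longrightarrow> time_average (T / real K) F n \<in> borel_measurable (lebesgue_on S)"
    "\<And>K n. n \<in> {1..K} \<Longrightarrow> AE x in lebesgue_on S. norm (time_average (T / real K) F n x) \<le> c"
    "\<And>K n. n \<in> {1..<K} \<Longrightarrow> AE x in lebesgue_on S.
        norm (time_average (T / real K) F (Suc n) x - time_average (T / real K) F n x) \<le> c * (T / real K)"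
proof -
  have S': "S \<in> sets lebesgue" using S by simp
  obtain G where FG: "F \<in> Linf_Linf T S" "G \<in> Linf_Linf T S"
    and deriv: "\<And>\<phi>::real \<Rightarrow> real. test_function {0<..<T} \<phi> \<Longrightarrow>
        AE x in lborel. x \<in> S \<longrightarrow> (LINT t|lebesgue_on {0<..<T}. deriv \<phi> t *\<^sub>R F t x)
             = - (LINT t|lebesgue_on {0<..<T}. \<phi> t *\<^sub>R G t x)"
    using F unfolding W1inf_Linf_def AE_lebesgue_on_iff[OF S'] by blast
  obtain g c where g[measurable]: "g \<in> borel_measurable borel" "0 \<le> c" "\<And>p. norm (g p) \<le> c"
    "AE x in lborel. x \<in> S \<longrightarrow> (AE t in lborel. t \<in> {0<..<T} \<longrightarrow> F t x = g (t, x))"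
    using Linf_Linf_bounded_borel_version[OF FG(1) S] by blast
  obtain h d where h: "h \<in> borel_measurable borel" "0 \<le> d" "\<And>p. norm (h p) \<le> d"
    "AE x in lborel. x \<in> S \<longrightarrow> (AE t in lborel. t \<in> {0<..<T} \<longrightarrow> G t x = h (t, x))"
    using Linf_Linf_bounded_borel_version[OF FG(2) S] by blast
  define A where "A \<tau> n x = (1 / \<tau>) *\<^sub>R (LINT t|lborel. indicator {real (n - 1) * \<tau>..real n * \<tau>} t *\<^sub>R g (t, x))"
    for \<tau> n x
  have average: "AE x in lborel. x \<in> S \<longrightarrow> time_average (T / real K) F n x = A (T / real K) n x"
    if "n \<in> {1..K}" for n K
    using g(4)
  proof eventually_elim
    case (elim x)
    have "real n * T / real K \<le> T"
      using that T by (simp add: field_simps)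
    then have J: "{real (n - 1) * (T / real K)..real n * (T / real K)} \<subseteq> {0..T}"
      using T by auto
    show ?case
      using integral_section_borel_version[of g "\<lambda>t. 1", OF g(1) _ _ J, of F x] elim
      by (auto simp: time_average_def A_def)
  qed
  have A_measurable: "A \<tau> n \<in> borel_measurable borel" for \<tau> n
  proof -
    have "(\<lambda>p. g (snd p, fst p)) \<in> borel_measurable (borel :: ('a \<times> real) measure)"
      using g(1) by (rule measurable_compose[rotated]) (auto intro!: borel_measurable_continuous_onI continuous_intros)
    then have [measurable]: "(\<lambda>(x, t). g (t, x)) \<in> borel_measurable (borel \<Otimes>\<^sub>M lborel)"
      by (simp add: case_prod_beta' borel_prod cong: measurable_cong_sets)
    show ?thesis unfolding A_def by measurable
  qed
  have A_bound: "norm (A (T / real K) n x) \<le> c" if "n \<in> {1..K}" for K n x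
  proof -
    define \<tau> where "\<tau> = T / real K"
    have \<tau>: "0 < \<tau>" using that T by (simp add: \<tau>_def)
    let ?J = "{real (n - 1) * \<tau>..real n * \<tau>}"
    have "norm (LINT t|lborel. indicator ?J t *\<^sub>R g (t, x)) \<le> (real n * \<tau> - real (n - 1) * \<tau>) * c"
      using g(2,3) \<tau>
      by (intro norm_integral_bounded_on_interval) (auto simp: indicator_def intro!: mult_right_mono)
    also have "real n * \<tau> - real (n - 1) * \<tau> = \<tau>"
      using that by (simp add: of_nat_diff algebra_simps)
    finally have "(1 / \<tau>) * norm (LINT t|lborel. indicator ?J t *\<^sub>R g (t, x)) \<le> (1 / \<tau>) * (\<tau> * c)"
      using \<tau> by (intro mult_left_mono) auto
    then show ?thesis using \<tau> unfolding A_def \<tau>_def[symmetric] by simp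
  qed
  have A_increment: "AE x in lborel. x \<in> S \<longrightarrow> norm (A (T / real K) (Suc n) x - A (T / real K) n x) \<le> 2 * d * (T / real K)"
    if n: "n \<in> {1..<K}" for K n
  proof -
    define \<tau> where "\<tau> = T / real K"
    define a where "a = real (n - 1) * \<tau>"
    have \<tau>: "0 < \<tau>" using n T by (simp add: \<tau>_def)
    have ends: "real n * \<tau> = a + \<tau>" "real (Suc n) * \<tau> = a + 2 * \<tau>"
      using n by (auto simp: a_def of_nat_diff algebra_simps)
    have "real (Suc n) * \<tau> \<le> real K * \<tau>" using n \<tau> by (intro mult_right_mono) auto
    also have "real K * \<tau> = T" using n by (simp add: \<tau>_def)
    finally have a: "0 \<le> a" "a + 2 * \<tau> \<le> T" using \<tau> unfolding ends by (auto simp: a_def)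
    have "AE x in lborel. x \<in> S \<longrightarrow>
        norm ((LINT t|lborel. indicator {a + \<tau>..a + 2 * \<tau>} t *\<^sub>R g (t, x))
          - (LINT t|lborel. indicator {a..a + \<tau>} t *\<^sub>R g (t, x))) \<le> 2 * \<tau>\<^sup>2 * d"
      by (rule W1inf_increment_bound[OF g(1,3,4) h(1,3,4) deriv a \<tau>])
    then show ?thesis
    proof eventually_elim
      case (elim x)
      show ?case
      proof
        assume "x \<in> S"
        let ?u = "LINT t|lborel. indicator {a + \<tau>..a + 2 * \<tau>} t *\<^sub>R g (t, x)"
        let ?v = "LINT t|lborel. indicator {a..a + \<tau>} t *\<^sub>R g (t, x)"
        have "A \<tau> (Suc n) x - A \<tau> n x = (1 / \<tau>) *\<^sub>R (?u - ?v)"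
          unfolding A_def a_def[symmetric] diff_Suc_1 ends by (simp add: scaleR_diff_right)
        then have "norm (A \<tau> (Suc n) x - A \<tau> n x) = (1 / \<tau>) * norm (?u - ?v)"
          using \<tau> by simp
        also have "\<dots> \<le> (1 / \<tau>) * (2 * \<tau>\<^sup>2 * d)"
          using elim \<open>x \<in> S\<close> \<tau> by (intro mult_left_mono) auto
        finally show "norm (A (T / real K) (Suc n) x - A (T / real K) n x) \<le> 2 * d * (T / real K)"
          using \<tau> unfolding \<tau>_def[symmetric] by (simp add: power2_eq_square algebra_simps)
      qed
    qed
  qed
  show thesis
  proof
    show "0 \<le> max c (2 * d)" using g(2) by simp
    fix K n :: nat
    {
      assume n: "n \<in> {1..K}"
      have "(\<lambda>x. if x \<in> S then A (T / real K) n x else 0) \<in> borel_measurable lebesgue"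
        using A_measurable S by (intro measurable_completion) auto
      then have "(\<lambda>x. if x \<in> S then time_average (T / real K) F n x else 0) \<in> borel_measurable lebesgue"
        by (rule borel_measurable_AE)
          (intro AE_completion, use average[OF n] in eventually_elim, auto)
      then show "time_average (T / real K) F n \<in> borel_measurable (lebesgue_on S)"
        using borel_measurable_if[OF S'] by blast
      show "AE x in lebesgue_on S. norm (time_average (T / real K) F n x) \<le> max c (2 * d)"
        unfolding AE_lebesgue_on_iff[OF S'] using average[OF n]
        by eventually_elim (auto intro: order_trans[OF A_bound[OF n]])
    }
    assume n: "n \<in> {1..<K}"
    then have n': "n \<in> {1..K}" "Suc n \<in> {1..K}" by auto
    have le: "2 * d * (T / real K) \<le> max c (2 * d) * (T / real K)"
      using T by (intro mult_right_mono) auto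
    show "AE x in lebesgue_on S. norm (time_average (T / real K) F (Suc n) x - time_average (T / real K) F n x)
        \<le> max c (2 * d) * (T / real K)"
      unfolding AE_lebesgue_on_iff[OF S'] using average[OF n'(1)] average[OF n'(2)] A_increment[OF n]
    proof eventually_elim
      case (elim x)
      show ?case
      proof
        assume "x \<in> S"
        with elim have "norm (time_average (T / real K) F (Suc n) x - time_average (T / real K) F n x)
            \<le> 2 * d * (T / real K)" by (simp only: simp_thms)
        also note le
        finally show "norm (time_average (T / real K) F (Suc n) x - time_average (T / real K) F n x)
            \<le> max c (2 * d) * (T / real K)" .
      qed
    qed
  qed
qed

section \<open>Fields with a weak curl\<close>

lemma square_integrable_L2: "b \<in> L2 S \<longleftrightarrow> square_integrable (lebesgue_on S) b"
  by (simp add: L2_def square_integrable_def)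

lemma L2_norm_on_squared: "(L2_norm_on S b)\<^sup>2 = (LINT x|lebesgue_on S. b x \<bullet> b x)"
  by (simp add: L2_norm_on_def power2_norm_eq_inner)

lemma Vspace_L2:
  assumes "b \<in> Vspace S"
  shows "square_integrable (lebesgue_on S) b" "square_integrable (lebesgue_on S) (weak_curl S b)"
proof -
  have "has_weak_curl S b (weak_curl S b)"
    using assms someI_ex[of "has_weak_curl S b"] by (simp add: Vspace_def weak_curl_def)
  then show "square_integrable (lebesgue_on S) b" "square_integrable (lebesgue_on S) (weak_curl S b)"
    by (auto simp: has_weak_curl_def square_integrable_L2)
qed

lemma norm_cross3_le: "norm (cross3 a b) \<le> norm a * norm b"
proof -
  have "(norm (cross3 a b))\<^sup>2 \<le> (norm a * norm b)\<^sup>2"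
    using norm_cross[of a b] by (simp add: power_mult_distrib)
  then show ?thesis by (rule power2_le_imp_le) simp
qed


section \<open>The quenched source term\<close>

text \<open>The nonlinearity of the alpha effect; \<open>\<sigma>\<close> measures how strongly a large field suppresses it.\<close>

definition quench :: "real \<Rightarrow> 'a::real_normed_vector \<Rightarrow> 'a" where
  "quench \<sigma> a = (1 / (1 + \<sigma> * (norm a)\<^sup>2)) *\<^sub>R a"

lemma quench_bound:
  assumes "0 \<le> \<sigma>"
  shows "norm (quench \<sigma> a) \<le> norm a"
proof -
  have "1 \<le> 1 + \<sigma> * (norm a)\<^sup>2" using assms by simp
  then have "norm a / (1 + \<sigma> * (norm a)\<^sup>2) \<le> norm a / 1"
    by (intro divide_left_mono) auto
  then show ?thesis using assms by (simp add: quench_def)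
qed

text \<open>With \<open>p = 1 + \<sigma> |a|\<^sup>2\<close> and \<open>q = 1 + \<sigma> |b|\<^sup>2\<close> write \<open>a / p - b / q = (a - b) / p + (1 / p - 1 / q) b\<close>. The second
  summand is small because \<open>1 / p - 1 / q\<close> contains the factor \<open>|b| - |a|\<close>, and the remaining factor
  \<open>\<sigma> |b| (|a| + |b|) / (p q)\<close> is at most one.\<close>

lemma quench_Lipschitz:
  fixes a b :: "'a::real_normed_vector"
  assumes \<sigma>: "0 \<le> \<sigma>"
  shows "norm (quench \<sigma> a - quench \<sigma> b) \<le> 2 * norm (a - b)"
proof -
  define p where "p = 1 + \<sigma> * (norm a)\<^sup>2"
  define q where "q = 1 + \<sigma> * (norm b)\<^sup>2"
  have p: "1 \<le> p" and q: "1 \<le> q" using \<sigma> by (simp_all add: p_def q_def)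
  have "1 / p - 1 / q = (\<sigma> * ((norm b)\<^sup>2 - (norm a)\<^sup>2)) / (p * q)"
    using p q by (simp add: p_def q_def field_simps)
  also have "\<dots> = (\<sigma> * (norm b + norm a)) * (norm b - norm a) / (p * q)"
    by (simp add: power2_eq_square algebra_simps)
  finally have "\<bar>1 / p - 1 / q\<bar> * norm b = (\<sigma> * (norm b + norm a) * norm b) / (p * q) * \<bar>norm b - norm a\<bar>"
    using p q \<sigma> by (simp add: abs_mult)
  also have "\<dots> \<le> 1 * norm (a - b)"
  proof (rule mult_mono)
    \<comment> \<open>The bound \<open>s \<le> 1 + s\<^sup>2\<close> for \<open>s = \<sigma> |a| |b|\<close>; both terms on the right occur in \<open>p q\<close>.\<close>
    have "\<sigma> * (norm a * norm b) \<le> 1 + (\<sigma> * (norm a * norm b))\<^sup>2"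
      using sum_squares_bound[of "\<sigma> * (norm a * norm b)" 1]
        mult_nonneg_nonneg[OF \<sigma> mult_nonneg_nonneg[OF norm_ge_zero norm_ge_zero], of a b]
      by simp
    moreover have "0 \<le> \<sigma> * (norm a)\<^sup>2" using \<sigma> by simp
    ultimately have "\<sigma> * (norm b + norm a) * norm b \<le> p * q"
      unfolding p_def q_def by (simp add: power2_eq_square algebra_simps)
    then show "(\<sigma> * (norm b + norm a) * norm b) / (p * q) \<le> 1"
      using p q by (simp add: divide_le_eq)
    show "\<bar>norm b - norm a\<bar> \<le> norm (a - b)"
      using norm_triangle_ineq3[of a b] by linarith
  qed auto
  finally have 1: "\<bar>1 / p - 1 / q\<bar> * norm b \<le> norm (a - b)" by simp
  have "quench \<sigma> a - quench \<sigma> b = (1 / p) *\<^sub>R (a - b) + (1 / p - 1 / q) *\<^sub>R b"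
    by (simp add: quench_def p_def q_def algebra_simps)
  also have "norm \<dots> \<le> norm ((1 / p) *\<^sub>R (a - b)) + norm ((1 / p - 1 / q) *\<^sub>R b)"
    by (rule norm_triangle_ineq)
  also have "norm ((1 / p) *\<^sub>R (a - b)) \<le> norm (a - b)"
    using p divide_left_mono[of 1 p "norm (a - b)"] by simp
  finally show ?thesis using 1 by simp
qed

text \<open>The field that is tested with the curl on the right-hand side of the scheme: alpha effect plus
  induction by the velocity \<open>u\<close>.\<close>

definition source :: "real \<Rightarrow> real \<Rightarrow> real \<Rightarrow> real \<Rightarrow> real^3 \<Rightarrow> real^3 \<Rightarrow> real^3" where
  "source R\<alpha> Rm \<sigma> f u b = (R\<alpha> * f) *\<^sub>R quench \<sigma> b + Rm *\<^sub>R cross3 u b"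

lemma source_bound:
  assumes "0 \<le> \<sigma>" "\<bar>f\<bar> \<le> cf" "norm u \<le> cu"
  shows "norm (source R\<alpha> Rm \<sigma> f u b) \<le> (\<bar>R\<alpha>\<bar> * cf + \<bar>Rm\<bar> * cu) * norm b"
proof -
  have "norm (source R\<alpha> Rm \<sigma> f u b) \<le> norm ((R\<alpha> * f) *\<^sub>R quench \<sigma> b) + norm (Rm *\<^sub>R cross3 u b)"
    unfolding source_def by (rule norm_triangle_ineq)
  also have "norm ((R\<alpha> * f) *\<^sub>R quench \<sigma> b) \<le> \<bar>R\<alpha>\<bar> * cf * norm b"
    unfolding norm_scaleR abs_mult using assms
    by (intro mult_mono mult_left_mono quench_bound) auto
  also have "norm (Rm *\<^sub>R cross3 u b) \<le> \<bar>Rm\<bar> * (cu * norm b)"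
    unfolding norm_scaleR using assms
    by (intro mult_left_mono order_trans[OF norm_cross3_le mult_right_mono]) auto
  finally show ?thesis by (simp add: algebra_simps)
qed

text \<open>The source is linear in the coefficients \<open>(f, u)\<close> and Lipschitz in the field, so a step changes it by
  a coefficient increment of order \<open>\<tau>\<close> and by a multiple of the field increment.\<close>

lemma source_increment:
  assumes "0 \<le> \<sigma>" "\<bar>f\<bar> \<le> cf" "norm u \<le> cu"
    and "\<bar>f' - f\<bar> \<le> cf * \<tau>" "norm (u' - u) \<le> cu * \<tau>" "0 \<le> \<tau>"
  shows "norm (source R\<alpha> Rm \<sigma> f' u' b' - source R\<alpha> Rm \<sigma> f u b)
    \<le> 2 * (\<bar>R\<alpha>\<bar> * cf + \<bar>Rm\<bar> * cu) * (\<tau> * norm b' + norm (b' - b))"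
proof -
  have c: "0 \<le> cf" "0 \<le> cu" using assms order_trans abs_ge_zero norm_ge_zero by metis+
  have cross: "cross3 u' b' - cross3 u b = cross3 (u' - u) b' + cross3 u (b' - b)"
    using cross_add_left[of "u' - u" u b'] cross_add_right[of u "b' - b" b] by simp
  have "source R\<alpha> Rm \<sigma> f' u' b' - source R\<alpha> Rm \<sigma> f u b
      = ((R\<alpha> * f') *\<^sub>R quench \<sigma> b' - (R\<alpha> * f) *\<^sub>R quench \<sigma> b) + Rm *\<^sub>R (cross3 u' b' - cross3 u b)"
    by (simp add: source_def scaleR_diff_right)
  also have "\<dots> = source R\<alpha> Rm \<sigma> (f' - f) (u' - u) b'
        + ((R\<alpha> * f) *\<^sub>R (quench \<sigma> b' - quench \<sigma> b) + Rm *\<^sub>R cross3 u (b' - b))"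
    unfolding cross
    by (simp add: source_def scaleR_add_right scaleR_diff_right scaleR_left_diff_distrib right_diff_distrib)
  also have "norm \<dots> \<le> norm (source R\<alpha> Rm \<sigma> (f' - f) (u' - u) b')
      + (norm ((R\<alpha> * f) *\<^sub>R (quench \<sigma> b' - quench \<sigma> b)) + norm (Rm *\<^sub>R cross3 u (b' - b)))"
    by (intro order_trans[OF norm_triangle_ineq] add_left_mono norm_triangle_ineq)
  also have "norm (source R\<alpha> Rm \<sigma> (f' - f) (u' - u) b') \<le> (\<bar>R\<alpha>\<bar> * (cf * \<tau>) + \<bar>Rm\<bar> * (cu * \<tau>)) * norm b'"
    using assms by (intro source_bound) auto
  also have "norm ((R\<alpha> * f) *\<^sub>R (quench \<sigma> b' - quench \<sigma> b)) \<le> (\<bar>R\<alpha>\<bar> * cf) * (2 * norm (b' - b))"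
    unfolding norm_scaleR abs_mult using assms c
    by (intro mult_mono mult_left_mono quench_Lipschitz) auto
  also have "norm (Rm *\<^sub>R cross3 u (b' - b)) \<le> \<bar>Rm\<bar> * (cu * norm (b' - b))"
    unfolding norm_scaleR using assms
    by (intro mult_left_mono order_trans[OF norm_cross3_le mult_right_mono]) auto
  finally have "norm (source R\<alpha> Rm \<sigma> f' u' b' - source R\<alpha> Rm \<sigma> f u b)
     \<le> (\<bar>R\<alpha>\<bar> * cf + \<bar>Rm\<bar> * cu) * (\<tau> * norm b') + (2 * (\<bar>R\<alpha>\<bar> * cf) + \<bar>Rm\<bar> * cu) * norm (b' - b)"
    by (simp add: algebra_simps)
  also have "\<dots> \<le> 2 * (\<bar>R\<alpha>\<bar> * cf + \<bar>Rm\<bar> * cu) * (\<tau> * norm b')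
      + 2 * (\<bar>R\<alpha>\<bar> * cf + \<bar>Rm\<bar> * cu) * norm (b' - b)"
    using c \<open>0 \<le> \<tau>\<close> by (intro add_mono mult_right_mono) auto
  finally show ?thesis by (simp add: distrib_left)
qed


section \<open>The spectral scheme\<close>

text \<open>The piecewise constant coefficient has no meaningful value on the interfaces, which are null sets.\<close>

lemma AE_off_interfaces: "AE x in lebesgue_on (ball 0 r3). norm (x::real^3) \<noteq> r"
proof -
  have "sphere 0 r \<in> null_sets (lebesgue :: (real^3) measure)"
    using negligible_sphere[of "0::real^3" r] by (simp add: negligible_iff_null_sets)
  then have "AE x in lebesgue. (x::real^3) \<notin> sphere 0 r" by (rule AE_not_in)
  then show ?thesis
    by (subst AE_restrict_space_iff) (auto elim: eventually_mono)
qed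

lemma beta_bar_measurable: "beta_bar r1 r2 r3 \<beta> \<in> borel_measurable (lebesgue_on S)"
proof -
  have "beta_bar r1 r2 r3 \<beta> \<in> borel_measurable borel"
    unfolding beta_bar_def zone1_def zone2_def zone3_def mem_Collect_eq by measurable
  then show ?thesis by (intro measurable_restrict_space1 measurable_completion) simp
qed

lemma beta_bar_bounds:
  assumes "0 < r1" "r1 < r2" "r2 < r3"
    and \<beta>: "\<forall>x\<in>ball 0 r3. \<beta>1 \<le> \<beta> x \<and> \<beta> x \<le> \<beta>2"
  shows "AE x in lebesgue_on (ball 0 r3).
    \<beta>1 \<le> \<beta> x \<and> \<beta> x \<le> beta_bar r1 r2 r3 \<beta> x \<and> beta_bar r1 r2 r3 \<beta> x \<le> \<beta>2"
proof -
  have SUP_bounds: "\<beta> x \<le> (SUP y\<in>Z. \<beta> y) \<and> (SUP y\<in>Z. \<beta> y) \<le> \<beta>2" if "x \<in> Z" "Z \<subseteq> ball 0 r3" for x Z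
  proof
    have "bdd_above (\<beta> ` Z)" using \<beta> that by (intro bdd_aboveI2[of _ _ \<beta>2]) auto
    then show "\<beta> x \<le> (SUP y\<in>Z. \<beta> y)" using that by (intro cSUP_upper)
    show "(SUP y\<in>Z. \<beta> y) \<le> \<beta>2" using \<beta> that by (intro cSUP_least) auto
  qed
  have zones: "zone1 r1 \<subseteq> ball 0 r3" "zone2 r1 r2 \<subseteq> ball 0 r3" "zone3 r2 r3 \<subseteq> ball 0 r3"
    using assms by (auto simp: zone1_def zone2_def zone3_def)
  show ?thesis
    using AE_off_interfaces[where r = r1] AE_off_interfaces[where r = r2] AE_space
  proof eventually_elim
    case (elim x)
    then have x: "x \<in> ball 0 r3" by simp
    consider "x \<in> zone1 r1" | "x \<notin> zone1 r1" "x \<in> zone2 r1 r2"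
      | "x \<notin> zone1 r1" "x \<notin> zone2 r1 r2" "x \<in> zone3 r2 r3"
      using elim by (fastforce simp: zone1_def zone2_def zone3_def)
    then show ?case
    proof cases
      case 1
      then show ?thesis using SUP_bounds[OF 1 zones(1)] \<beta> x by (simp add: beta_bar_def)
    next
      case 2
      then show ?thesis using SUP_bounds[OF 2(2) zones(2)] \<beta> x by (simp add: beta_bar_def)
    next
      case 3
      then show ?thesis using SUP_bounds[OF 3(3) zones(3)] \<beta> x by (simp add: beta_bar_def)
    qed
  qed
qed

text \<open>Both \<open>b n\<close> and \<open>b (n - 1)\<close> belong to the discrete space, hence are admissible test fields, and their
  weak curls are square integrable. The factor \<open>2\<close> in the constant is the Lipschitz constant of
  the quenching.\<close>

lemma scheme_solution_lagged_diffusion: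
  fixes \<beta> :: "real^3 \<Rightarrow> real" and r3 :: real
  defines "S \<equiv> ball (0 :: real^3) r3"
  assumes r: "0 < r1" "r1 < r2" "r2 < r3" and T: "0 < T" and \<sigma>: "0 \<le> \<sigma>" and \<beta>1: "0 < \<beta>1"
    and \<beta>_measurable: "\<beta> \<in> borel_measurable (lebesgue_on S)"
    and \<beta>: "\<forall>x\<in>S. \<beta>1 \<le> \<beta> x \<and> \<beta> x \<le> \<beta>2"
    and cf: "0 \<le> cf" and cu: "0 \<le> cu" and K: "0 < K" and \<tau>: "\<tau> = T / real K"
    and f_measurable: "\<And>n. n \<in> {1..K} \<Longrightarrow> time_average \<tau> f n \<in> borel_measurable (lebesgue_on S)"
    and f_bound: "\<And>n. n \<in> {1..K} \<Longrightarrow> AE x in lebesgue_on S. norm (time_average \<tau> f n x) \<le> cf"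
    and f_increment: "\<And>n. n \<in> {1..<K} \<Longrightarrow> AE x in lebesgue_on S.
        norm (time_average \<tau> f (Suc n) x - time_average \<tau> f n x) \<le> cf * \<tau>"
    and u_measurable: "\<And>n. n \<in> {1..K} \<Longrightarrow> time_average \<tau> u n \<in> borel_measurable (lebesgue_on S)"
    and u_bound: "\<And>n. n \<in> {1..K} \<Longrightarrow> AE x in lebesgue_on S. norm (time_average \<tau> u n x) \<le> cu"
    and u_increment: "\<And>n. n \<in> {1..<K} \<Longrightarrow> AE x in lebesgue_on S.
        norm (time_average \<tau> u (Suc n) x - time_average \<tau> u n x) \<le> cu * \<tau>"
    and sol: "scheme_solution r1 r2 r3 R\<alpha> Rm \<sigma> \<beta> f u b_init N M \<tau> K b"
  shows "lagged_diffusion_scheme (lebesgue_on S) b (\<lambda>n. weak_curl S (b n))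
    (\<lambda>n x. source R\<alpha> Rm \<sigma> (time_average \<tau> f n x) (time_average \<tau> u n x) (b (n - 1) x))
    \<beta> (beta_bar r1 r2 r3 \<beta>) \<beta>1 \<beta>2 (2 * (\<bar>R\<alpha>\<bar> * cf + \<bar>Rm\<bar> * cu)) T \<tau> K"
proof -
  let ?w = "\<lambda>n. weak_curl S (b n)" and ?\<beta>b = "beta_bar r1 r2 r3 \<beta>"
  let ?f = "time_average \<tau> f" and ?u = "time_average \<tau> u"
  let ?F = "\<lambda>n x. source R\<alpha> Rm \<sigma> (?f n x) (?u n x) (b (n - 1) x)"
  let ?c = "2 * (\<bar>R\<alpha>\<bar> * cf + \<bar>Rm\<bar> * cu)"
  have \<tau>_pos: "0 < \<tau>" using T K by (simp add: \<tau>)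
  have c: "0 \<le> \<bar>R\<alpha>\<bar> * cf + \<bar>Rm\<bar> * cu" using cf cu by simp
  have b_V: "b n \<in> V_space_N r1 r2 r3 N M" if "n \<le> K" for n
    using sol that by (simp add: scheme_solution_def Let_def)
  then have V: "b n \<in> Vspace S" if "n \<le> K" for n using that by (auto simp: V_space_N_def S_def)
  note b_L2 = Vspace_L2(1)[OF V] and w_L2 = Vspace_L2(2)[OF V]
  have b_measurable: "b n \<in> borel_measurable (lebesgue_on S)" if "n \<le> K" for n
    using b_L2[OF that] by (simp add: square_integrable_def)
  have cross_measurable: "(\<lambda>x. cross3 (?u n x) (b (n - 1) x)) \<in> borel_measurable (lebesgue_on S)"
    if "n \<in> {1..K}" for n
    using that by (intro borel_measurable_bilinear[OF bilinear_cross] u_measurable b_measurable)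
      (auto simp: S_def)
  have F_bound: "AE x in lebesgue_on S. norm (?F n x) \<le> ?c * norm (b (n - 1) x)" if "n \<in> {1..K}" for n
    using f_bound[OF that] u_bound[OF that]
  proof eventually_elim
    case (elim x)
    have "norm (?F n x) \<le> (\<bar>R\<alpha>\<bar> * cf + \<bar>Rm\<bar> * cu) * norm (b (n - 1) x)"
      using elim \<sigma> by (intro source_bound) auto
    also have "\<bar>R\<alpha>\<bar> * cf + \<bar>Rm\<bar> * cu \<le> ?c"
      unfolding mult_2 using c by (rule le_add_same_cancel1[THEN iffD2])
    finally show ?case by (simp add: mult_right_mono)
  qed
  have F_increment: "AE x in lebesgue_on S. norm (?F (Suc n) x - ?F n x)
      \<le> ?c * (\<tau> * norm (b n x) + norm (b n x - b (n - 1) x))" if n: "n \<in> {1..<K}" for n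
  proof -
    have n': "n \<in> {1..K}" using n by auto
    show ?thesis
      using f_bound[OF n'] u_bound[OF n'] f_increment[OF n] u_increment[OF n]
    proof eventually_elim
      case (elim x)
      then show ?case
        using source_increment[OF \<sigma>, of "?f n x" cf "?u n x" cu "?f (Suc n) x" \<tau> "?u (Suc n) x"
            R\<alpha> Rm "b n x" "b (n - 1) x"] \<tau>_pos by simp
    qed
  qed
  have scheme: "(1 / \<tau>) * (LINT x|lebesgue_on S. (b n x - b (n - 1) x) \<bullet> b m x)
        + (LINT x|lebesgue_on S. ?\<beta>b x * (?w n x \<bullet> ?w m x))
      = (LINT x|lebesgue_on S. (?\<beta>b x - \<beta> x) * (?w (n - 1) x \<bullet> ?w m x))
        + (LINT x|lebesgue_on S. ?F n x \<bullet> ?w m x)"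
    if n: "n \<in> {1..K}" and m: "m \<in> {n - 1, n}" for n m
  proof -
    have le: "n - 1 \<le> K" "m \<le> K" using n m by auto
    have "(LINT x|lebesgue_on S. diff_quot \<tau> b n x \<bullet> b m x) +
          (LINT x|lebesgue_on S. ?\<beta>b x * (?w n x \<bullet> ?w m x))
        = (LINT x|lebesgue_on S. (?\<beta>b x - \<beta> x) * (?w (n - 1) x \<bullet> ?w m x)) +
          R\<alpha> * (LINT x|lebesgue_on S. (?f n x / (1 + \<sigma> * (norm (b (n - 1) x))\<^sup>2)) * (b (n - 1) x \<bullet> ?w m x)) +
          Rm * (LINT x|lebesgue_on S. cross3 (?u n x) (b (n - 1) x) \<bullet> ?w m x)"
      using sol n b_V[OF le(2)] unfolding scheme_solution_def Let_def S_def by blast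
    moreover have "(LINT x|lebesgue_on S. diff_quot \<tau> b n x \<bullet> b m x)
        = (1 / \<tau>) * (LINT x|lebesgue_on S. (b n x - b (n - 1) x) \<bullet> b m x)"
      unfolding diff_quot_def inner_scaleR_left by (rule integral_mult_right_zero)
    moreover have "(LINT x|lebesgue_on S. ?F n x \<bullet> ?w m x)
        = R\<alpha> * (LINT x|lebesgue_on S. (?f n x / (1 + \<sigma> * (norm (b (n - 1) x))\<^sup>2)) * (b (n - 1) x \<bullet> ?w m x)) +
          Rm * (LINT x|lebesgue_on S. cross3 (?u n x) (b (n - 1) x) \<bullet> ?w m x)"
    proof -
      note [measurable] = f_measurable[OF n] b_measurable[OF le(1)] cross_measurable[OF n]
      have int_f: "integrable (lebesgue_on S) (\<lambda>x. (?f n x / (1 + \<sigma> * (norm (b (n - 1) x))\<^sup>2)) * (b (n - 1) x \<bullet> ?w m x))"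
      proof (rule square_integrable_bounded_mult[OF b_L2[OF le(1)] w_L2[OF le(2)]])
        show "AE x in lebesgue_on S. \<bar>?f n x / (1 + \<sigma> * (norm (b (n - 1) x))\<^sup>2)\<bar> \<le> cf"
          using f_bound[OF n]
        proof eventually_elim
          case (elim x)
          have "\<bar>?f n x\<bar> / (1 + \<sigma> * (norm (b (n - 1) x))\<^sup>2) \<le> \<bar>?f n x\<bar> / 1"
            using \<sigma> by (intro divide_left_mono) (auto intro: add_pos_nonneg)
          then show ?case using elim \<sigma> by simp
        qed
      qed measurable
      have int_u: "integrable (lebesgue_on S) (\<lambda>x. cross3 (?u n x) (b (n - 1) x) \<bullet> ?w m x)"
      proof (rule square_integrable_inner[OF square_integrable_dominated[OF b_L2[OF le(1)]] w_L2[OF le(2)]])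
        show "AE x in lebesgue_on S. norm (cross3 (?u n x) (b (n - 1) x)) \<le> cu * norm (b (n - 1) x)"
          using u_bound[OF n]
          by eventually_elim (auto intro: order_trans[OF norm_cross3_le mult_right_mono])
      qed measurable
      have "?F n x \<bullet> ?w m x
          = R\<alpha> * ((?f n x / (1 + \<sigma> * (norm (b (n - 1) x))\<^sup>2)) * (b (n - 1) x \<bullet> ?w m x))
            + Rm * (cross3 (?u n x) (b (n - 1) x) \<bullet> ?w m x)" for x
        by (simp add: source_def quench_def inner_add_left)
      then show ?thesis
        by (simp only: integral_mult_right_zero
            Bochner_Integration.integral_add[OF integrable_mult_right[OF int_f] integrable_mult_right[OF int_u]])
    qed
    ultimately show ?thesis by simp
  qed
  show ?thesis
  proof unfold_locales
    show "0 \<le> ?c" using c by (rule mult_nonneg_nonneg[rotated]) simp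
    show "AE x in lebesgue_on S. \<beta>1 \<le> \<beta> x \<and> \<beta> x \<le> ?\<beta>b x \<and> ?\<beta>b x \<le> \<beta>2"
      using beta_bar_bounds[OF r] \<beta> unfolding S_def by blast
    show "?F n \<in> borel_measurable (lebesgue_on S)" if "n \<in> {1..K}" for n
    proof -
      have [measurable]: "b (n - 1) \<in> borel_measurable (lebesgue_on S)" using that by (intro b_measurable) auto
      note [measurable] = f_measurable[OF that] cross_measurable[OF that]
      show ?thesis unfolding source_def quench_def by measurable
    qed
  qed (use \<beta>1 T K \<tau> \<beta>_measurable beta_bar_measurable b_L2 w_L2 F_bound F_increment scheme in auto)
qed

theorem theorem4p1:
  fixes r1 r2 r3 T R\<alpha> Rm \<sigma> \<beta>1 \<beta>2 :: real
    and \<beta> :: "real^3 \<Rightarrow> real"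
    and f :: "real \<Rightarrow> real^3 \<Rightarrow> real"
    and u :: "real \<Rightarrow> real^3 \<Rightarrow> real^3"
    and b0 :: "real^3 \<Rightarrow> real^3"
    and Proj :: "nat \<Rightarrow> nat \<Rightarrow> (real^3 \<Rightarrow> real^3) \<Rightarrow> real^3 \<Rightarrow> real^3"
    and \<Omega> :: "(real^3) set"
  assumes "\<Omega> = ball 0 r3"
    and "0 < r1" "r1 < r2" "r2 < r3" "0 < T" "0 \<le> \<sigma>"
    and "0 < \<beta>1" "\<beta>1 \<le> \<beta>2"
    and "\<beta> \<in> borel_measurable (lebesgue_on \<Omega>)"
    and "\<forall>x\<in>\<Omega>. \<beta>1 \<le> \<beta> x \<and> \<beta> x \<le> \<beta>2"
    and "\<beta> constant_on zone2 r1 r2"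
    and "\<forall>t\<in>{0<..<T}. \<forall>x\<in>closure (zone1 r1) \<union> closure (zone3 r2 r3). f t x = 0 \<and> u t x = 0"
    and "f \<in> W1inf_Linf T \<Omega>"
    and "u \<in> W1inf_Linf T \<Omega>"
    and "b0 \<in> Vspace \<Omega>"
    and "\<forall>N M. projection_onto \<Omega> (V_space_N r1 r2 r3 N M) (Proj N M)"
  shows "\<exists>C>0. \<forall>N M K b \<tau>.
    0 < K \<longrightarrow> \<tau> = T / real K \<longrightarrow>
    scheme_solution r1 r2 r3 R\<alpha> Rm \<sigma> \<beta> f u (Proj N M b0) N M \<tau> K b \<longrightarrow>
      (MAX n\<in>{1..K}. (L2_norm_on \<Omega> (b n))\<^sup>2) +
        \<tau> * (\<Sum>n=1..K. (L2_norm_on \<Omega> (weak_curl \<Omega> (b n)))\<^sup>2)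
        \<le> C * ((V_norm \<Omega> (b 0))\<^sup>2 + \<tau> * (L2_norm_on \<Omega> (weak_curl \<Omega> (b 0)))\<^sup>2) \<and>
      (MAX n\<in>{1..K}. (L2_norm_on \<Omega> (weak_curl \<Omega> (b n)))\<^sup>2) +
        \<tau> * (\<Sum>n=1..K. (L2_norm_on \<Omega> (diff_quot \<tau> b n))\<^sup>2)
        \<le> C * (V_norm \<Omega> (b 0))\<^sup>2"
proof -
  note \<Omega> = assms(1)
  have S: "\<Omega> \<in> sets borel" by (simp add: \<Omega>)
  obtain cf where cf: "0 \<le> cf"
    "\<And>K n. n \<in> {1..K} \<Longrightarrow> time_average (T / real K) f n \<in> borel_measurable (lebesgue_on \<Omega>)"
    "\<And>K n. n \<in> {1..K} \<Longrightarrow> AE x in lebesgue_on \<Omega>. norm (time_average (T / real K) f n x) \<le> cf"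
    "\<And>K n. n \<in> {1..<K} \<Longrightarrow> AE x in lebesgue_on \<Omega>.
        norm (time_average (T / real K) f (Suc n) x - time_average (T / real K) f n x) \<le> cf * (T / real K)"
    using time_average_bounds[OF \<open>f \<in> W1inf_Linf T \<Omega>\<close> S \<open>0 < T\<close>] by blast
  obtain cu where cu: "0 \<le> cu"
    "\<And>K n. n \<in> {1..K} \<Longrightarrow> time_average (T / real K) u n \<in> borel_measurable (lebesgue_on \<Omega>)"
    "\<And>K n. n \<in> {1..K} \<Longrightarrow> AE x in lebesgue_on \<Omega>. norm (time_average (T / real K) u n x) \<le> cu"
    "\<And>K n. n \<in> {1..<K} \<Longrightarrow> AE x in lebesgue_on \<Omega>.
        norm (time_average (T / real K) u (Suc n) x - time_average (T / real K) u n x) \<le> cu * (T / real K)"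
    using time_average_bounds[OF \<open>u \<in> W1inf_Linf T \<Omega>\<close> S \<open>0 < T\<close>] by blast
  define c where "c = 2 * (\<bar>R\<alpha>\<bar> * cf + \<bar>Rm\<bar> * cu)"
  define A1 where "A1 = energy_const \<beta>1 \<beta>2 c T"
  define A2 where "A2 = dissipation_const \<beta>1 \<beta>2 c T"
  have \<beta>2: "0 \<le> \<beta>2" using \<open>0 < \<beta>1\<close> \<open>\<beta>1 \<le> \<beta>2\<close> by simp
  have A1: "0 < A1" using \<beta>2 by (simp add: A1_def energy_const_def)
  define C where "C = max ((1 + 1 / \<beta>1) * A1) ((1 + 2 / \<beta>1) * A2)"
  have "0 < (1 + 1 / \<beta>1) * A1" using A1 \<open>0 < \<beta>1\<close> by (intro mult_pos_pos add_pos_pos) auto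
  then have "0 < C" by (simp add: C_def)
  moreover have "(MAX n\<in>{1..K}. (L2_norm_on \<Omega> (b n))\<^sup>2) +
        \<tau> * (\<Sum>n=1..K. (L2_norm_on \<Omega> (weak_curl \<Omega> (b n)))\<^sup>2)
        \<le> C * ((V_norm \<Omega> (b 0))\<^sup>2 + \<tau> * (L2_norm_on \<Omega> (weak_curl \<Omega> (b 0)))\<^sup>2) \<and>
      (MAX n\<in>{1..K}. (L2_norm_on \<Omega> (weak_curl \<Omega> (b n)))\<^sup>2) +
        \<tau> * (\<Sum>n=1..K. (L2_norm_on \<Omega> (diff_quot \<tau> b n))\<^sup>2)
        \<le> C * (V_norm \<Omega> (b 0))\<^sup>2"
    if K: "0 < K" and \<tau>: "\<tau> = T / real K"
      and sol: "scheme_solution r1 r2 r3 R\<alpha> Rm \<sigma> \<beta> f u (Proj N M b0) N M \<tau> K b" for N M K b \<tau>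
  proof -
    interpret lagged_diffusion_scheme "lebesgue_on \<Omega>" b "\<lambda>n. weak_curl \<Omega> (b n)"
      "\<lambda>n x. source R\<alpha> Rm \<sigma> (time_average \<tau> f n x) (time_average \<tau> u n x) (b (n - 1) x)"
      \<beta> "beta_bar r1 r2 r3 \<beta>" \<beta>1 \<beta>2 c T \<tau> K
      unfolding c_def \<Omega>
      by (rule scheme_solution_lagged_diffusion[OF _ _ _ _ _ _ _ _ cf(1) cu(1) K \<tau> _ _ _ _ _ _ sol])
        (use assms cf(2-) cu(2-) \<tau> in auto)
    let ?B = "\<lambda>n. (L2_norm_on \<Omega> (b n))\<^sup>2" and ?W = "\<lambda>n. (L2_norm_on \<Omega> (weak_curl \<Omega> (b n)))\<^sup>2"
    have BW: "?B n = B n" "?W n = W n" for n by (simp_all add: L2_norm_on_squared B_def W_def)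
    have V: "(V_norm \<Omega> (b 0))\<^sup>2 = B 0 + W 0"
      using nonneg(1,2)[of 0] by (simp add: V_norm_def BW)
    have diff: "(L2_norm_on \<Omega> (diff_quot \<tau> b n))\<^sup>2 = (1 / \<tau>) * ((1 / \<tau>) * D n)" for n
      by (simp add: L2_norm_on_squared diff_quot_def D_def)
    have K_mem: "K \<in> {1..K}" using K by simp
    have sumW: "0 \<le> \<tau> * (\<Sum>n=1..k. W n)" for k
      using \<tau>_pos nonneg by (intro mult_nonneg_nonneg sum_nonneg) auto
    have sumD: "0 \<le> (1 / \<tau>) * (\<Sum>n=1..k. D n)" for k
      using \<tau>_pos nonneg by (intro mult_nonneg_nonneg sum_nonneg) auto
    let ?Y = "B 0 + \<tau> * W 0"
    have energy: "B k + \<beta>1 * (\<tau> * (\<Sum>n=1..k. W n)) \<le> A1 * ?Y" if "k \<le> K" for k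
      unfolding A1_def by (rule energy_estimate[OF that \<beta>2])
    have "(MAX n\<in>{1..K}. B n) \<le> A1 * ?Y"
    proof (rule Max.boundedI)
      fix y assume "y \<in> B ` {1..K}"
      then obtain k where k: "k \<le> K" "y = B k" by auto
      have "0 \<le> \<beta>1 * (\<tau> * (\<Sum>n=1..k. W n))" by (rule mult_nonneg_nonneg[OF less_imp_le[OF \<beta>1_pos] sumW])
      then show "y \<le> A1 * ?Y" using energy[OF k(1)] k(2) by linarith
    qed (use K in auto)
    moreover have "\<tau> * (\<Sum>n=1..K. W n) \<le> (1 / \<beta>1) * (A1 * ?Y)"
      using energy[of K] nonneg(1)[of K] \<beta>1_pos by (simp add: field_simps)
    ultimately have "(MAX n\<in>{1..K}. B n) + \<tau> * (\<Sum>n=1..K. W n) \<le> ((1 + 1 / \<beta>1) * A1) * ?Y"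
      by (simp add: algebra_simps)
    also have "\<dots> \<le> C * (B 0 + W 0 + \<tau> * W 0)"
      using \<tau>_pos nonneg \<open>0 < C\<close> by (intro mult_mono) (auto simp: C_def)
    finally have 1: "(MAX n\<in>{1..K}. B n) + \<tau> * (\<Sum>n=1..K. W n) \<le> C * (B 0 + W 0 + \<tau> * W 0)" .

    let ?Z = "A2 * (B 0 + W 0)"
    have dissipation: "(1 / \<tau>) * (\<Sum>n=1..k. D n) + \<beta>1 / 2 * W k \<le> ?Z" if "k \<in> {1..K}" for k
      unfolding A2_def by (rule dissipation_estimate[OF that \<beta>2])
    have "(MAX n\<in>{1..K}. W n) \<le> (2 / \<beta>1) * ?Z"
    proof (rule Max.boundedI)
      fix y assume "y \<in> W ` {1..K}"
      then obtain k where k: "k \<in> {1..K}" "y = W k" by auto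
      have "\<beta>1 / 2 * y \<le> ?Z" unfolding k(2) using dissipation[OF k(1)] sumD[of k] by linarith
      then show "y \<le> (2 / \<beta>1) * ?Z" using \<beta>1_pos by (simp add: field_simps)
    qed (use K in auto)
    moreover have "\<tau> * (\<Sum>n=1..K. (1 / \<tau>) * ((1 / \<tau>) * D n)) \<le> ?Z"
    proof -
      have "0 \<le> \<beta>1 / 2 * W K" using \<beta>1_pos nonneg by simp
      then have "(1 / \<tau>) * (\<Sum>n=1..K. D n) \<le> ?Z" using dissipation[OF K_mem] by linarith
      then show ?thesis using \<tau>_pos by (simp add: sum_distrib_left[symmetric] sum_divide_distrib[symmetric])
    qed
    ultimately have "(MAX n\<in>{1..K}. W n) + \<tau> * (\<Sum>n=1..K. (1 / \<tau>) * ((1 / \<tau>) * D n)) \<le> ((1 + 2 / \<beta>1) * A2) * (B 0 + W 0)"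
      by (simp add: algebra_simps)
    also have "\<dots> \<le> C * (B 0 + W 0)"
      using nonneg(1,2)[of 0] by (intro mult_right_mono) (auto simp: C_def)
    finally have 2: "(MAX n\<in>{1..K}. W n) + \<tau> * (\<Sum>n=1..K. (1 / \<tau>) * ((1 / \<tau>) * D n)) \<le> C * (B 0 + W 0)" .
    show ?thesis using 1 2 unfolding BW V diff by blast
  qed
  ultimately show ?thesis by blast
qed

end
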